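(* Let $\mathcal{Q}$ be an $[\![n,k,d]\!]$ stabilizer code and suppose that there are $m$ blocks of $\mathcal{Q}$. The logical Clifford group $\bar{\mathcal{C}}_{mk}$ defined on the total $mk$ logical qubits can be generated by combining logical gates from the following three sets: 1. the set of logical transversal Clifford gates $$\left\{\bigotimes_{j=1}^{k} \bar{H}_{p:j},\; \bigotimes_{j=1}^{k} \bar{S}_{p:j}^{a_j},\; \bigotimes_{j=1}^{k} \overline{\mathrm{CNOT}}_{p:j,q:j} \right\} \quad\forall p,q \in [m],\ p\neq q,\; \forall (a_1,\dots,a_k)\in\{-1,1\}^k;$$ 2. and any one of the following sets of logical gates inside a code block: (a) $\{\bar{H}_{p:j},\;\overline{\mathrm{CNOT}}_{p:j,p:l}\}$ for all $p \in [m]$ and all $j, l \in [k]$, $j\neq l$; or (b) $\{\bar{S}_{p:j},\;\overline{\mathrm{CNOT}}_{p:j,p:l}\}$ for all $p \in [m]$ and all $j, l \in [k]$, $j\neq l$; or (c) $\{\bar{H}_{p:j},\;\overline{\mathrm{CZ}}_{p:j,p:l}\}$ for all $p \in [m]$ and all $j, l \in [k]$, $j\neq l$; or (d) $\{\overline{\mathrm{CNOT}}_{p:j,p:l},\;\overline{\mathrm{CZ}}_{p:j,p:l}\}$ for all $p \in [m]$ and all $j, l \in [k]$, $j\neq l$; 3. and any one of the following sets of logical gates between code blocks: (a) $\{\overline{\mathrm{CNOT}}_{p:1,q:1}\}$ for all $p,q \in [m]$, $p\neq q$; or (b) $\{\overline{\mathrm{CZ}}_{p:1,q:1}\}$ for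 all $p,q \in [m]$, $p\neq q$. (That is, for each choice of one set from item 2 and one set from item 3, the union of these with the set in item 1 generates $\bar{\mathcal{C}}_{mk}$. In items 2(a)-(c), the single-qubit gates are included for all $p\in[m]$, $j\in[k]$.)
   Context: $[m]=\{1,\dots,m\}$. Each block of $\mathcal{Q}$ encodes $k$ logical qubits. $\bar G_{p:j}$ denotes a logical single-qubit gate acting on the $j$-th logical qubit of the $p$-th code block, and $\bar F_{p:j,q:l}$ denotes a logical two-qubit gate acting on the $j$-th logical qubit of the $p$-th block and the $l$-th logical qubit of the $q$-th block (for CNOT, the first is the control and the second the target). $H$ is the Hadamard gate, $S=\mathrm{diag}(1,i)$ the phase gate, CZ the controlled-$Z$ gate. The Clifford group on $n$ qubits is $\mathcal{C}_n=\{A\in\mathcal{U}_n : AMA^\dagger\in\mathcal{P}_n\ \forall M\in\mathcal{P}_n\}$, with $\mathcal{U}_n$ the unitary group and $\mathcal{P}_n$ the Pauli group on $n$ qubits; generation is understood up to global phase (in this sense $\mathcal{C}_n$ is generated by $H$ and $S$ on every qubit and CNOT on every ordered pair of qubits). $\bar{\mathcal{C}}_{mk}$ is the Clifford group acting on the $mk$ logical qubits. *)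

theory Defs
  imports "HOL-Analysis.Analysis" "HOL-Algebra.Generated_Groups"
begin

(* A register of qubits is indexed by a finite type 'q; its computational basis is the set of
   bit assignments 'q \<Rightarrow> bool (False for |0>, True for |1>), so that operators on (C^2)^{\<otimes>'q}
   are square matrices over this index type. *)
type_synonym 'q operator = "complex^('q \<Rightarrow> bool)^('q \<Rightarrow> bool)"
type_synonym gate1 = "complex^bool^bool"
type_synonym gate2 = "complex^(bool \<times> bool)^(bool \<times> bool)"

definition dagger :: "complex^'a^'b \<Rightarrow> complex^'b^'a" where
  "dagger A = (\<chi> i j. cnj (A $ j $ i))"

definition unitaries :: "(complex^'a::finite^'a) set" where
  "unitaries = {U. dagger U ** U = mat 1 \<and> U ** dagger U = mat 1}"

definition unitary_group :: "(complex^'a::finite^'a) monoid" where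
  "unitary_group = \<lparr>carrier = unitaries, mult = (**), one = mat 1\<rparr>"

definition hadamard :: gate1 where
  "hadamard = (\<chi> x y. (if x \<and> y then -1 else 1) / complex_of_real (sqrt 2))"

(* S^a for an integer a, where S = diag(1, i). *)
definition phase_pow :: "int \<Rightarrow> gate1" where
  "phase_pow a = (\<chi> x y. if x = y then (if x then \<i> powi a else 1) else 0)"

(* The first component of an index is the control qubit, the second one the target qubit. *)
definition cnot :: gate2 where
  "cnot = (\<chi> x y. if fst x = fst y \<and> snd x = (snd y \<noteq> fst y) then 1 else 0)"

definition cz :: gate2 where
  "cz = (\<chi> x y. if x = y then (if fst x \<and> snd x then -1 else 1) else 0)"

(* The tensor product of the single-qubit operators A q over all qubits q. *)
definition tensor :: "('q::finite \<Rightarrow> gate1) \<Rightarrow> 'q operator" where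
  "tensor A = (\<chi> x y. \<Prod>q\<in>UNIV. A q $ x q $ y q)"

definition on_qubit :: "gate1 \<Rightarrow> 'q \<Rightarrow> 'q::finite operator" where
  "on_qubit G q = tensor (\<lambda>r. if r = q then G else mat 1)"

(* For pairwise disjoint ordered pairs E of distinct qubits: the tensor product of copies of F,
   one acting on each pair in E, with the identity on all qubits not covered by E. *)
definition on_pairs :: "gate2 \<Rightarrow> ('q \<times> 'q) set \<Rightarrow> 'q::finite operator" where
  "on_pairs F E = (\<chi> x y. (\<Prod>(a, b)\<in>E. F $ (x a, x b) $ (y a, y b)) *
     (\<Prod>r\<in>- (fst ` E \<union> snd ` E). if x r = y r then 1 else 0))"

datatype pauli = PI | PX | PY | PZ

fun pauli_gate :: "pauli \<Rightarrow> gate1" where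
  "pauli_gate PI = mat 1"
| "pauli_gate PX = (\<chi> x y. if x \<noteq> y then 1 else 0)"
| "pauli_gate PY = (\<chi> x y. if x \<noteq> y then (if x then \<i> else - \<i>) else 0)"
| "pauli_gate PZ = (\<chi> x y. if x = y then (if x then -1 else 1) else 0)"

definition pauli_string :: "('q \<Rightarrow> pauli) \<Rightarrow> 'q::finite operator" where
  "pauli_string P = tensor (\<lambda>q. pauli_gate (P q))"

definition weight :: "('q::finite \<Rightarrow> pauli) \<Rightarrow> nat" where
  "weight P = card {q. P q \<noteq> PI}"

definition pauli_group :: "'q::finite operator set" where
  "pauli_group = {mat (\<i> ^ c) ** pauli_string P | c P. True}"

definition clifford_group :: "'q::finite operator set" where
  "clifford_group = {A \<in> unitaries. \<forall>M\<in>pauli_group. A ** M ** dagger A \<in> pauli_group}"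

definition code_space :: "'n::finite operator set \<Rightarrow> (complex^('n \<Rightarrow> bool)) set" where
  "code_space \<S> = {v. \<forall>M\<in>\<S>. M *v v = v}"

(* Pauli strings that commute with the stabilizer \<S> but do not lie in \<S>, even up to a phase:
   the nontrivial logical Pauli operators. *)
definition nontrivial_logical :: "'n::finite operator set \<Rightarrow> ('n \<Rightarrow> pauli) set" where
  "nontrivial_logical \<S> = {P. (\<forall>M\<in>\<S>. pauli_string P ** M = M ** pauli_string P) \<and>
     (\<forall>c::nat. mat (\<i> ^ c) ** pauli_string P \<notin> \<S>)}"

(* \<S> is the stabilizer group of an [[n,k,d]] code with n = CARD('n) and k \<ge> 1. *)
definition stabilizer_code :: "'n::finite operator set \<Rightarrow> nat \<Rightarrow> nat \<Rightarrow> bool" where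
  "stabilizer_code \<S> k d \<longleftrightarrow>
     subgroup \<S> unitary_group \<and> \<S> \<subseteq> pauli_group \<and>
     (\<forall>M\<in>\<S>. \<forall>N\<in>\<S>. M ** N = N ** M) \<and> mat (-1) \<notin> \<S> \<and>
     1 \<le> k \<and> k \<le> CARD('n) \<and> card \<S> = 2 ^ (CARD('n) - k) \<and>
     d = Min (weight ` nontrivial_logical \<S>)"

(* V identifies the register 'k of logical qubits with the code space: it is an isometry onto the
   code space under which the logical Pauli operators are induced by physical ones. *)
definition encoding ::
    "'n::finite operator set \<Rightarrow> complex^('k::finite \<Rightarrow> bool)^('n \<Rightarrow> bool) \<Rightarrow> bool" where
  "encoding \<S> V \<longleftrightarrow> dagger V ** V = mat 1 \<and> range ((*v) V) = code_space \<S> \<and>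
     (\<forall>M\<in>pauli_group. \<exists>M'\<in>pauli_group. M' ** V = V ** M)"

(* The tensor product of copies of V, one for each block in 'm; qubit j of block p is (p, j). *)
definition block_encoding ::
    "complex^('k \<Rightarrow> bool)^('n \<Rightarrow> bool)
     \<Rightarrow> complex^('m::finite \<times> 'k::finite \<Rightarrow> bool)^('m \<times> 'n::finite \<Rightarrow> bool)" where
  "block_encoding V =
     (\<chi> x y. \<Prod>p\<in>UNIV. V $ (\<lambda>i. x (p, i)) $ (\<lambda>j. y (p, j)))"

(* The logical operator induced by U: it acts on the range of the encoding W as U acts on the
   logical qubits. It is represented by its extension by 0 to the orthogonal complement. *)
definition logical :: "complex^'a^'b \<Rightarrow> complex^'a::finite^'a \<Rightarrow> complex^'b::finite^'b" where
  "logical W U = W ** U ** dagger W"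

(* The unitary group of the range of W; its unit is the projector onto that range. *)
definition logical_unitary_group ::
    "complex^'a::finite^'b::finite \<Rightarrow> (complex^'b^'b) monoid" where
  "logical_unitary_group W =
     \<lparr>carrier = logical W ` unitaries, mult = (**), one = logical W (mat 1)\<rparr>"

definition generate_up_to_phase ::
    "(complex^'b::finite^'b) monoid \<Rightarrow> (complex^'b^'b) set \<Rightarrow> (complex^'b^'b) set" where
  "generate_up_to_phase G A = {mat \<omega> ** B | \<omega> B. cmod \<omega> = 1 \<and> B \<in> generate G A}"

definition transversal_gates :: "('m::finite \<times> 'k::finite) operator set" where
  "transversal_gates =
     {tensor (\<lambda>(r, j). if r = p then hadamard else mat 1) | p. True} \<union>
     {tensor (\<lambda>(r, j). if r = p then phase_pow (a j) else mat 1) | p a. range a \<subseteq> {-1, 1}} \<union>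
     {on_pairs cnot {((p, j), (q, j)) | j. True} | p q. p \<noteq> q}"

definition block_hadamard :: "('m::finite \<times> 'k::finite) operator set" where
  "block_hadamard = {on_qubit hadamard (p, j) | p j. True}"

definition block_phase :: "('m::finite \<times> 'k::finite) operator set" where
  "block_phase = {on_qubit (phase_pow 1) (p, j) | p j. True}"

definition block_pairs :: "gate2 \<Rightarrow> ('m::finite \<times> 'k::finite) operator set" where
  "block_pairs F = {on_pairs F {((p, j), (p, l))} | p j l. j \<noteq> l}"

definition intra_block_choices :: "('m::finite \<times> 'k::finite) operator set set" where
  "intra_block_choices =
     {block_hadamard \<union> block_pairs cnot,
      block_phase \<union> block_pairs cnot,
      block_hadamard \<union> block_pairs cz,
      block_pairs cnot \<union> block_pairs cz}"

definition inter_pairs :: "gate2 \<Rightarrow> 'k \<Rightarrow> ('m::finite \<times> 'k::finite) operator set" where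
  "inter_pairs F j = {on_pairs F {((p, j), (q, j))} | p q. p \<noteq> q}"

definition inter_block_choices :: "'k \<Rightarrow> ('m::finite \<times> 'k::finite) operator set set" where
  "inter_block_choices j = {inter_pairs cnot j, inter_pairs cz j}"

end

theory Submission
  imports Defs
begin

text \<open>
  The encoding is an isometry, so generation on the code space reduces to generation on the logical
  register, and every listed gate is Clifford.

  For the converse, let \<open>G\<close> be a group of unitaries containing the phases and all H, S and CNOT gates.
  It contains the rotations \<open>(1 + R) / sqrt 2\<close> for all Pauli operators \<open>R\<close> with \<open>R R = -1\<close>: these are
  closed under products of anticommuting pairs, which reduces every \<open>R\<close> to Pauli operators on at most
  two qubits. The rotation about \<open>M' M\<close> conjugates \<open>M\<close> to \<open>M'\<close> for anticommuting Pauli involutions.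
  Hence, qubit by qubit, a Clifford operator can be multiplied by elements of \<open>G\<close> until it commutes with
  all X and Z operators, and then it is a phase.

  It remains to find H, S and CNOT among products of the listed gates. Conjugating the transversal S by
  a CNOT and dividing by the transversal S leaves \<open>S\<^sub>j CZ\<^sub>j\<^sub>l\<close>; conjugating \<open>S\<^sub>j\<close> by the transversal H
  gives HSH on qubit \<open>j\<close>, and H is a phase times S (HSH) S. The commutator of CNOTs along \<open>a \<rightarrow> b \<rightarrow> c\<close>
  is the CNOT from \<open>a\<close> to \<open>c\<close>, so one CNOT between two blocks yields all of them.
\<close>

section \<open>Matrices and the encoding\<close>

definition cscale :: "complex \<Rightarrow> complex^'a^'b \<Rightarrow> complex^'a^'b"  (infixr \<open>*\<^sub>c\<close> 76) where
  "c *\<^sub>c A = (\<chi> i j. c * A $ i $ j)"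

lemma cscale_nth [simp]: "(c *\<^sub>c A) $ i $ j = c * A $ i $ j"
  by (simp add: cscale_def)

text \<open>Simplification turns every scalar factor \<open>mat c\<close> into a prefix
  \<open>*\<^sub>c\<close> and moves it outwards through products, so that phases collect in
  front.\<close>

lemma mat_mult_cscale [simp]: "mat c ** A = c *\<^sub>c A" for A :: "complex^'a::finite^'b::finite"
  by (simp add: vec_eq_iff matrix_matrix_mult_def mat_def if_distrib if_distribR cong: if_cong)

lemma mult_mat_cscale [simp]: "A ** mat c = c *\<^sub>c A" for A :: "complex^'a::finite^'b::finite"
  by (simp add: vec_eq_iff matrix_matrix_mult_def mat_def if_distrib if_distribR mult.commute cong: if_cong)

lemma cscale_mult_left [simp]: "(c *\<^sub>c A) ** B = c *\<^sub>c (A ** B)"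
  for A :: "complex^'a::finite^'b::finite" and B :: "complex^'c::finite^'a"
  by (simp add: vec_eq_iff matrix_matrix_mult_def sum_distrib_left mult.assoc)

lemma cscale_mult_right [simp]: "A ** (c *\<^sub>c B) = c *\<^sub>c (A ** B)"
  for A :: "complex^'a::finite^'b::finite" and B :: "complex^'c::finite^'a"
  by (simp add: vec_eq_iff matrix_matrix_mult_def sum_distrib_left algebra_simps)

lemma cscale_cscale [simp]: "c *\<^sub>c d *\<^sub>c A = (c * d) *\<^sub>c A"
  by (simp add: vec_eq_iff mult.assoc)

lemma cscale_one [simp]: "1 *\<^sub>c A = A"
  by (simp add: vec_eq_iff)

lemma cscale_mat [simp]: "c *\<^sub>c mat d = mat (c * d)"
  by (simp add: vec_eq_iff mat_def)

lemma cscale_minus_left [simp]: "(- c) *\<^sub>c A = - (c *\<^sub>c A)"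
  by (simp add: vec_eq_iff)

lemma cscale_minus_right [simp]: "c *\<^sub>c (- A) = - (c *\<^sub>c A)"
  by (simp add: vec_eq_iff)

lemma cscale_add_right: "c *\<^sub>c (A + B) = c *\<^sub>c A + c *\<^sub>c B"
  by (simp add: vec_eq_iff algebra_simps)

lemma matrix_mult_minus_left [simp]: "(- A) ** B = - (A ** B)"
  for A :: "complex^'a::finite^'b::finite" and B :: "complex^'c::finite^'a"
  using cscale_mult_left[of "-1" A B] by simp

lemma matrix_mult_minus_right [simp]: "A ** (- B) = - (A ** B)"
  for A :: "complex^'a::finite^'b::finite" and B :: "complex^'c::finite^'a"
  using cscale_mult_right[of A "-1" B] by simp

lemma dagger_nth [simp]: "dagger A $ i $ j = cnj (A $ j $ i)"
  by (simp add: dagger_def)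

lemma dagger_dagger [simp]: "dagger (dagger A) = A"
  by (simp add: vec_eq_iff)

lemma dagger_mult [simp]: "dagger (A ** B) = dagger B ** dagger A"
  for A :: "complex^'a::finite^'b::finite" and B :: "complex^'c::finite^'a"
  by (simp add: vec_eq_iff matrix_matrix_mult_def mult.commute)

lemma dagger_cscale [simp]: "dagger (c *\<^sub>c A) = cnj c *\<^sub>c dagger A"
  by (simp add: vec_eq_iff)

lemma dagger_mat [simp]: "dagger (mat c) = mat (cnj c)"
  by (auto simp: vec_eq_iff mat_def)

lemma dagger_minus [simp]: "dagger (- A) = - dagger A"
  by (simp add: vec_eq_iff)

lemma dagger_add [simp]: "dagger (A + B) = dagger A + dagger B"
  by (simp add: vec_eq_iff)

section \<open>Unitary matrices and the unitary group\<close>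

lemma unitariesD:
  assumes "U \<in> unitaries"
  shows "dagger U ** U = mat 1" "U ** dagger U = mat 1"
    "dagger U ** (U ** A) = A" "U ** (dagger U ** A) = A"
  using assms by (simp_all add: unitaries_def matrix_mul_assoc)

text \<open>For square matrices a one-sided inverse is two-sided.\<close>

lemma unitariesI:
  assumes "U ** dagger U = mat 1"
  shows "U \<in> unitaries"
  using assms matrix_left_right_inverse by (auto simp: unitaries_def)

lemma unitaries_mult: "U \<in> unitaries \<Longrightarrow> V \<in> unitaries \<Longrightarrow> U ** V \<in> unitaries"
  by (rule unitariesI) (simp add: unitariesD flip: matrix_mul_assoc)

lemma unitaries_dagger: "U \<in> unitaries \<Longrightarrow> dagger U \<in> unitaries"
  by (simp add: unitaries_def)

lemma cnj_mult_self_eq_1: "cmod \<omega> = 1 \<Longrightarrow> \<omega> * cnj \<omega> = 1" "cmod \<omega> = 1 \<Longrightarrow> cnj \<omega> * \<omega> = 1"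
  using complex_norm_square[of \<omega>] by (simp_all add: mult.commute)

lemma unitaries_mat: "cmod \<omega> = 1 \<Longrightarrow> mat \<omega> \<in> unitaries"
  by (rule unitariesI) (simp add: cnj_mult_self_eq_1)

lemma unitaries_cscale: "cmod \<omega> = 1 \<Longrightarrow> U \<in> unitaries \<Longrightarrow> \<omega> *\<^sub>c U \<in> unitaries"
  using unitaries_mult[OF unitaries_mat] by simp

lemma group_unitary_group: "group (unitary_group :: (complex^'a::finite^'a) monoid)"
proof (rule groupI)
  fix U :: "complex^'a^'a"
  assume "U \<in> carrier unitary_group"
  then show "\<exists>V\<in>carrier unitary_group. V \<otimes>\<^bsub>unitary_group\<^esub> U = \<one>\<^bsub>unitary_group\<^esub>"
    by (intro bexI[of _ "dagger U"]) (auto simp: unitary_group_def unitariesD unitaries_dagger)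
qed (auto simp: unitary_group_def unitaries_mult unitaries_mat matrix_mul_assoc)

lemma inv_unitary_group: "U \<in> unitaries \<Longrightarrow> inv\<^bsub>unitary_group\<^esub> U = dagger U"
  by (rule group.inv_equality[OF group_unitary_group])
    (auto simp: unitary_group_def unitariesD unitaries_dagger)

section \<open>Transfer of generation from the logical register to the code space\<close>

lemma group_hom_logical:
  fixes W :: "complex^'a::finite^'b::finite"
  assumes "dagger W ** W = mat 1"
  shows "group_hom unitary_group (logical_unitary_group W) (logical W)"
proof -
  have mult: "logical W (A ** B) = logical W A ** logical W B" for A B
  proof -
    have "logical W A ** logical W B = W ** A ** (dagger W ** W) ** B ** dagger W"
      by (simp add: logical_def matrix_mul_assoc)
    then show ?thesis
      by (simp add: assms logical_def matrix_mul_assoc)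
  qed
  \<comment> \<open>All matrices under multiplication: not a group, but a multiplicative image of a
    group inside it is one, with the image of the unit, here the projector
    \<open>W ** dagger W\<close>, as its unit.\<close>
  let ?H = "\<lparr>carrier = UNIV, mult = (**), one = mat 1\<rparr> :: (complex^'b^'b) monoid"
  interpret group "unitary_group :: (complex^'a^'a) monoid"
    by (rule group_unitary_group)
  have "logical W \<in> hom unitary_group ?H"
    by (simp add: hom_def mult unitary_group_def)
  from hom_imp_img_group[OF this] have "group (logical_unitary_group W)"
    by (simp add: logical_unitary_group_def unitary_group_def)
  then show ?thesis
    by (intro group_hom.intro group_hom_axioms.intro group_unitary_group)
      (auto simp: hom_def mult unitary_group_def logical_unitary_group_def)
qed

lemma logical_cscale: "logical W (c *\<^sub>c A) = c *\<^sub>c logical W A"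
  by (simp add: logical_def)

lemma generate_up_to_phase_alt:
  "generate_up_to_phase G A = (\<Union>\<omega>\<in>{\<omega>. cmod \<omega> = 1}. (*\<^sub>c) \<omega> ` generate G A)"
  by (auto simp: generate_up_to_phase_def)

text \<open>Homomorphisms map the subgroup generated by a set onto the one generated by its image,
  and phases pass through the linear map \<open>logical W\<close>.\<close>

lemma generate_up_to_phase_logical:
  fixes W :: "complex^'a::finite^'b::finite"
  assumes "dagger W ** W = mat 1" and "A \<subseteq> unitaries"
  shows "generate_up_to_phase (logical_unitary_group W) (logical W ` A)
    = logical W ` generate_up_to_phase unitary_group A"
proof -
  have "generate (logical_unitary_group W) (logical W ` A) = logical W ` generate unitary_group A"
    using group_hom.generate_img[OF group_hom_logical[OF assms(1)]] assms(2)
    by (simp add: unitary_group_def)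
  then show ?thesis
    by (simp add: generate_up_to_phase_alt image_UN image_image logical_cscale)
qed

section \<open>Tensor powers of an encoding\<close>

text \<open>Distributivity. It factorises sums over all basis states in products of tensor
  products.\<close>

lemma prod_sum_functions:
  fixes f :: "'q::finite \<Rightarrow> 'a::finite \<Rightarrow> 'c::comm_semiring_1"
  shows "(\<Sum>x\<in>UNIV. \<Prod>q\<in>UNIV. f q (x q)) = (\<Prod>q\<in>UNIV. \<Sum>a\<in>UNIV. f q a)"
  using prod_sum_PiE[of UNIV "\<lambda>_. UNIV" f] by (simp add: PiE_def extensional_def)

lemma prod_of_bool:
  assumes "finite A"
  shows "(\<Prod>q\<in>A. of_bool (P q)) = (of_bool (\<forall>q\<in>A. P q) :: 'c::comm_semiring_1)"
  using assms by (induction A) auto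

lemma bij_curry: "bij (curry :: ('a \<times> 'b \<Rightarrow> 'c) \<Rightarrow> _)"
  by (rule bij_betw_byWitness[of _ case_prod]) auto

text \<open>Currying splits a bit assignment of all blocks into one assignment per block. The sum
  over physical basis states then factorises over the blocks, and each factor is an entry of
  \<open>dagger V ** V\<close>.\<close>

lemma block_encoding_isometry:
  fixes V :: "complex^('k::finite \<Rightarrow> bool)^('n::finite \<Rightarrow> bool)"
  assumes "dagger V ** V = mat 1"
  shows "dagger (block_encoding V) ** block_encoding V
    = (mat 1 :: complex^('m::finite \<times> 'k \<Rightarrow> bool)^('m \<times> 'k \<Rightarrow> bool))"
proof -
  have V: "(\<Sum>x\<in>UNIV. cnj (V $ x $ a) * V $ x $ b) = of_bool (a = b)" for a b
    using arg_cong[OF assms, of "\<lambda>M. M $ a $ b"]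
    by (simp add: matrix_matrix_mult_def mat_def of_bool_def)
  have "(\<Sum>x\<in>UNIV. (\<Prod>p\<in>UNIV. cnj (V $ (\<lambda>i. x (p, i)) $ (\<lambda>j. y (p, j)))) *
      (\<Prod>p\<in>UNIV. V $ (\<lambda>i. x (p, i)) $ (\<lambda>j. z (p, j)))) = of_bool (y = z)"
    for y z :: "'m \<times> 'k \<Rightarrow> bool"
  proof -
    let ?f = "\<lambda>p a. cnj (V $ a $ curry y p) * V $ a $ curry z p"
    have "(\<Sum>x\<in>UNIV. (\<Prod>p\<in>UNIV. cnj (V $ (\<lambda>i. x (p, i)) $ (\<lambda>j. y (p, j)))) *
        (\<Prod>p\<in>UNIV. V $ (\<lambda>i. x (p, i)) $ (\<lambda>j. z (p, j))))
      = (\<Sum>x\<in>UNIV. \<Prod>p\<in>UNIV. ?f p (curry x p))"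
      by (simp add: prod.distrib curry_def)
    also have "\<dots> = (\<Sum>x\<in>UNIV. \<Prod>p\<in>UNIV. ?f p (x p))"
      by (rule sum.reindex_bij_betw[OF bij_curry, of "\<lambda>x. \<Prod>p\<in>UNIV. ?f p (x p)"])
    also have "\<dots> = (\<Prod>p\<in>UNIV. of_bool (curry y p = curry z p))"
      unfolding prod_sum_functions[of ?f] by (simp only: V)
    also have "\<dots> = of_bool (y = z)"
      by (simp add: prod_of_bool curry_def fun_eq_iff)
    finally show ?thesis .
  qed
  then show ?thesis
    by (simp add: vec_eq_iff matrix_matrix_mult_def block_encoding_def mat_def)
qed

section \<open>Gates as matrices\<close>

lemma tensor_nth: "tensor A $ x $ y = (\<Prod>q\<in>UNIV. A q $ x q $ y q)"
  by (simp add: tensor_def)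

lemma tensor_mult: "tensor A ** tensor B = tensor (\<lambda>q. A q ** B q)"
proof -
  have "(\<Sum>z\<in>UNIV. (\<Prod>q\<in>UNIV. A q $ x q $ z q) * (\<Prod>q\<in>UNIV. B q $ z q $ y q))
    = (\<Prod>q\<in>UNIV. \<Sum>u\<in>UNIV. A q $ x q $ u * B q $ u $ y q)" for x y :: "'a \<Rightarrow> bool"
    using prod_sum_functions[of "\<lambda>q u. A q $ x q $ u * B q $ u $ y q"] by (simp add: prod.distrib)
  then show ?thesis
    by (simp add: vec_eq_iff matrix_matrix_mult_def tensor_nth)
qed

lemma tensor_cscale: "tensor (\<lambda>q. c q *\<^sub>c A q) = (\<Prod>q\<in>UNIV. c q) *\<^sub>c tensor A"
  by (simp add: vec_eq_iff tensor_nth prod.distrib)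

lemma dagger_tensor: "dagger (tensor A) = tensor (\<lambda>q. dagger (A q))"
  by (simp add: vec_eq_iff tensor_nth)

lemma tensor_one [simp]: "tensor (\<lambda>_. mat 1) = mat 1"
  by (simp add: vec_eq_iff tensor_nth mat_def prod_of_bool fun_eq_iff flip: of_bool_def)

lemma prod_fun_except:
  fixes f :: "'q::finite \<Rightarrow> 'c::comm_monoid_mult"
  assumes "\<And>r. r \<noteq> q \<Longrightarrow> f r = 1"
  shows "(\<Prod>r\<in>UNIV. f r) = f q"
proof -
  have "(\<Prod>r\<in>UNIV. f r) = (\<Prod>r\<in>{q}. f r)"
    using assms by (intro prod.mono_neutral_right) auto
  then show ?thesis by simp
qed

lemma on_qubit_mult: "on_qubit G q ** on_qubit H q = on_qubit (G ** H) q"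
  by (auto simp: on_qubit_def tensor_mult intro!: arg_cong[of _ _ tensor])

lemma on_qubit_cscale: "on_qubit (c *\<^sub>c G) q = c *\<^sub>c on_qubit G q"
proof -
  have "on_qubit (c *\<^sub>c G) q = tensor (\<lambda>r. (if r = q then c else 1) *\<^sub>c (if r = q then G else mat 1))"
    by (auto simp: on_qubit_def intro!: arg_cong[of _ _ tensor])
  also have "\<dots> = c *\<^sub>c on_qubit G q"
    by (simp add: tensor_cscale on_qubit_def prod_fun_except[of q])
  finally show ?thesis .
qed

lemma on_qubit_one [simp]: "on_qubit (mat 1) q = mat 1"
  by (simp add: on_qubit_def)

lemma dagger_on_qubit: "dagger (on_qubit G q) = on_qubit (dagger G) q"
  by (auto simp: on_qubit_def dagger_tensor intro!: arg_cong[of _ _ tensor])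

lemma on_qubit_nth:
  "on_qubit G q $ x $ y = (if \<forall>r. r \<noteq> q \<longrightarrow> x r = y r then G $ x q $ y q else 0)"
proof -
  have "on_qubit G q $ x $ y = G $ x q $ y q * (\<Prod>r\<in>UNIV - {q}. of_bool (x r = y r))"
    by (simp add: on_qubit_def tensor_nth prod.remove[of UNIV q] mat_def of_bool_def)
  also have "(\<Prod>r\<in>UNIV - {q}. of_bool (x r = y r)) = (of_bool (\<forall>r. r \<noteq> q \<longrightarrow> x r = y r) :: complex)"
    by (subst prod_of_bool) auto
  finally show ?thesis
    by simp
qed

lemma sum_fun_upd_bool:
  fixes f :: "('q::finite \<Rightarrow> bool) \<Rightarrow> 'c::comm_monoid_add"
  assumes "\<And>z. z \<noteq> x(q := z q) \<Longrightarrow> f z = 0"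
  shows "sum f UNIV = f (x(q := True)) + f (x(q := False))"
proof -
  have "z = x(q := True) \<or> z = x(q := False)" if "f z \<noteq> 0" for z
    using assms[of z] that by (cases "z q") auto
  then have "sum f UNIV = sum f {x(q := True), x(q := False)}"
    by (intro sum.mono_neutral_right) auto
  also have "\<dots> = f (x(q := True)) + f (x(q := False))"
    by (subst sum.insert) (auto simp: fun_eq_iff)
  finally show ?thesis .
qed

text \<open>A single-qubit gate links \<open>x\<close> only to assignments that agree with
  \<open>x\<close> off \<open>q\<close>, so two terms of the matrix product survive.\<close>

lemma on_qubit_mult_nth:
  "(on_qubit G q ** M) $ x $ y
    = G $ x q $ True * M $ (x(q := True)) $ y + G $ x q $ False * M $ (x(q := False)) $ y"
  unfolding matrix_matrix_mult_def
  by (simp, subst sum_fun_upd_bool[of x q]) (auto simp: on_qubit_nth fun_eq_iff split: if_splits)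

lemma mult_on_qubit_nth:
  "(M ** on_qubit G q) $ x $ y
    = M $ x $ (y(q := True)) * G $ True $ y q + M $ x $ (y(q := False)) * G $ False $ y q"
  unfolding matrix_matrix_mult_def
  by (simp, subst sum_fun_upd_bool[of y q]) (auto simp: on_qubit_nth fun_eq_iff split: if_splits)

section \<open>Permutation and diagonal matrices\<close>

text \<open>The basis state \<open>y\<close> is sent to \<open>f y\<close>. With CNOT in this form
  and S, CZ and Z as \<open>diag_op\<close>, gate identities become identities of functions on bit
  assignments.\<close>

definition perm_op :: "('a \<Rightarrow> 'a) \<Rightarrow> complex^'a^'a" where
  "perm_op f = (\<chi> x y. if x = f y then 1 else 0)"

definition diag_op :: "('a \<Rightarrow> complex) \<Rightarrow> complex^'a^'a" where
  "diag_op d = (\<chi> x y. if x = y then d x else 0)"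

lemma diag_op_nth: "diag_op d $ x $ y = (if x = y then d x else 0)"
  by (simp add: diag_op_def)

lemma mult_perm_op_nth: "(M ** perm_op f) $ x $ y = M $ x $ f y"
  by (simp add: matrix_matrix_mult_def perm_op_def if_distrib cong: if_cong)

lemma perm_op_mult_nth:
  assumes "\<And>x. f (f x) = x"
  shows "(perm_op f ** M) $ x $ y = M $ f x $ y"
proof -
  have "x = f z \<longleftrightarrow> z = f x" for z
    using assms by metis
  then show ?thesis
    by (simp add: matrix_matrix_mult_def perm_op_def if_distrib if_distribR cong: if_cong)
qed

lemma perm_op_mult: "perm_op f ** perm_op g = perm_op (f \<circ> g)"
  by (simp add: vec_eq_iff mult_perm_op_nth) (simp add: perm_op_def)

lemma perm_op_id: "perm_op (\<lambda>x. x) = mat 1"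
  by (simp add: vec_eq_iff perm_op_def mat_def)

lemma dagger_perm_op:
  assumes "\<And>x. f (f x) = x"
  shows "dagger (perm_op f) = perm_op f"
  using assms by (auto simp: vec_eq_iff perm_op_def)

lemma diag_op_mult_nth: "(diag_op d ** M) $ x $ y = d x * M $ x $ y"
  by (simp add: matrix_matrix_mult_def diag_op_def if_distrib if_distribR cong: if_cong)

lemma diag_op_mult: "diag_op d ** diag_op e = diag_op (\<lambda>x. d x * e x)"
  by (simp add: vec_eq_iff diag_op_mult_nth) (simp add: diag_op_nth)

lemma dagger_diag_op: "dagger (diag_op d) = diag_op (\<lambda>x. cnj (d x))"
  by (auto simp add: vec_eq_iff diag_op_def)

lemma diag_op_one: "diag_op (\<lambda>_. 1) = mat 1"
  by (simp add: vec_eq_iff diag_op_def mat_def)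

lemma cscale_diag_op: "c *\<^sub>c diag_op d = diag_op (\<lambda>x. c * d x)"
  by (simp add: vec_eq_iff diag_op_def)

lemma perm_diag_perm:
  assumes "\<And>x. f (f x) = x"
  shows "perm_op f ** diag_op d ** perm_op f = diag_op (\<lambda>x. d (f x))"
proof -
  have "f x = f y \<longleftrightarrow> x = y" for x y
    using assms by metis
  then show ?thesis
    by (simp add: vec_eq_iff mult_perm_op_nth perm_op_mult_nth[OF assms] diag_op_nth)
qed

lemma tensor_diag_op:
  "tensor (\<lambda>q. diag_op (d q)) = diag_op (\<lambda>x. \<Prod>q\<in>UNIV. d q (x q))"
proof -
  have "(\<Prod>q\<in>UNIV. if x q = y q then d q (x q) else 0)
      = (if x = y then \<Prod>q\<in>UNIV. d q (x q) else 0)" for x y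
  proof (cases "x = y")
    case False
    then obtain q where "x q \<noteq> y q"
      by auto
    with False show ?thesis
      by (auto intro!: prod_zero)
  qed simp
  then show ?thesis
    by (simp add: vec_eq_iff tensor_nth diag_op_nth)
qed

section \<open>CNOT and CZ gates on a register\<close>

abbreviation flip_target :: "'q \<Rightarrow> 'q \<Rightarrow> ('q \<Rightarrow> bool) \<Rightarrow> 'q \<Rightarrow> bool" where
  "flip_target a b \<equiv> \<lambda>y. y(b := (y b \<noteq> y a))"

text \<open>Each qubit lies in at most one pair and in one position only. In this case
  \<open>on_pairs\<close> is a genuine tensor product of two-qubit gates.\<close>

definition disjoint_pairs :: "('q \<times> 'q) set \<Rightarrow> bool" where
  "disjoint_pairs E \<longleftrightarrow> inj_on fst E \<and> inj_on snd E \<and> fst ` E \<inter> snd ` E = {}"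

lemma on_pairs_single_nth:
  assumes "a \<noteq> b"
  shows "on_pairs F {(a, b)} $ x $ y
    = (if \<forall>r. r \<noteq> a \<and> r \<noteq> b \<longrightarrow> x r = y r then F $ (x a, x b) $ (y a, y b) else 0)"
  by (auto simp: on_pairs_def prod_of_bool simp flip: of_bool_def)

lemma on_pairs_cz: "a \<noteq> b \<Longrightarrow> on_pairs cz {(a, b)} = diag_op (\<lambda>x. if x a \<and> x b then -1 else 1)"
  by (auto simp: vec_eq_iff on_pairs_single_nth diag_op_def cz_def fun_eq_iff)

lemma on_pairs_cnot: "a \<noteq> b \<Longrightarrow> on_pairs cnot {(a, b)} = perm_op (flip_target a b)"
  by (auto simp: vec_eq_iff on_pairs_single_nth perm_op_def cnot_def fun_eq_iff)

lemma on_pairs_cnot_disjoint: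
  assumes "disjoint_pairs E"
  shows "on_pairs cnot E = perm_op (\<lambda>y r. y r \<noteq> (\<exists>c. (c, r) \<in> E \<and> y c))"
proof -
  have entry: "on_pairs cnot E $ x $ y = of_bool ((\<forall>(a, b)\<in>E. x a = y a \<and> x b = (y b \<noteq> y a)) \<and>
      (\<forall>r\<in>- (fst ` E \<union> snd ` E). x r = y r))" for x y
  proof -
    have "on_pairs cnot E $ x $ y = (\<Prod>e\<in>E. of_bool (case e of (a, b) \<Rightarrow> x a = y a \<and> x b = (y b \<noteq> y a))) *
        (\<Prod>r\<in>- (fst ` E \<union> snd ` E). of_bool (x r = y r))"
      by (simp add: on_pairs_def cnot_def case_prod_unfold of_bool_def)
    then show ?thesis
      by (simp only: prod_of_bool finite of_bool_conj)
  qed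
  have eq: "(\<forall>(a, b)\<in>E. x a = y a \<and> x b = (y b \<noteq> y a)) \<and> (\<forall>r\<in>- (fst ` E \<union> snd ` E). x r = y r)
      \<longleftrightarrow> x = (\<lambda>r. y r \<noteq> (\<exists>c. (c, r) \<in> E \<and> y c))" (is "?L \<longleftrightarrow> ?R") for x y :: "'a \<Rightarrow> bool"
  proof -
    \<comment> \<open>A control is never a target, so its bit is kept; a target has exactly one
      control, so the existential reduces to that bit.\<close>
    have control: "(\<nexists>c. (c, a) \<in> E)" if "(a, b) \<in> E" for a b
      using assms that by (force simp: disjoint_pairs_def)
    have target: "(c, b) \<in> E \<longleftrightarrow> c = a" if "(a, b) \<in> E" for a b c
      using assms that by (force simp: disjoint_pairs_def inj_on_def)
    have rest: "(\<exists>c. (c, r) \<in> E \<and> y c) = False" if "r \<in> - snd ` E" for r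
      using that by force
    have "x = (\<lambda>r. y r \<noteq> (\<exists>c. (c, r) \<in> E \<and> y c)) \<longleftrightarrow>
        (\<forall>r\<in>fst ` E. x r = (y r \<noteq> (\<exists>c. (c, r) \<in> E \<and> y c))) \<and>
        (\<forall>r\<in>snd ` E. x r = (y r \<noteq> (\<exists>c. (c, r) \<in> E \<and> y c))) \<and>
        (\<forall>r\<in>- (fst ` E \<union> snd ` E). x r = (y r \<noteq> (\<exists>c. (c, r) \<in> E \<and> y c)))"
      unfolding fun_eq_iff by blast
    also have "(\<forall>r\<in>fst ` E. x r = (y r \<noteq> (\<exists>c. (c, r) \<in> E \<and> y c))) \<longleftrightarrow> (\<forall>(a, b)\<in>E. x a = y a)"
      using control by (auto simp: case_prod_unfold)
    also have "(\<forall>r\<in>snd ` E. x r = (y r \<noteq> (\<exists>c. (c, r) \<in> E \<and> y c)))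
        \<longleftrightarrow> (\<forall>(a, b)\<in>E. x b = (y b \<noteq> y a))"
      using target by (auto simp: case_prod_unfold)
    also have "(\<forall>r\<in>- (fst ` E \<union> snd ` E). x r = (y r \<noteq> (\<exists>c. (c, r) \<in> E \<and> y c)))
        \<longleftrightarrow> (\<forall>r\<in>- (fst ` E \<union> snd ` E). x r = y r)"
      using rest by (intro ball_cong) auto
    finally show ?thesis
      by (simp only: case_prod_unfold ball_conj_distrib conj_assoc)
  qed
  have "on_pairs cnot E $ x $ y = perm_op (\<lambda>y r. y r \<noteq> (\<exists>c. (c, r) \<in> E \<and> y c)) $ x $ y" for x y
    unfolding entry eq perm_op_def by (simp only: vec_lambda_beta of_bool_def)
  then show ?thesis
    by (simp add: vec_eq_iff)
qed

text \<open>No gate in \<open>E\<close> targets \<open>a\<close> or \<open>b\<close>, so the new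
  CNOT can be applied last. Peeling off one gate at a time reduces transversal CNOTs to single
  ones.\<close>

lemma on_pairs_cnot_insert:
  assumes "disjoint_pairs (insert (a, b) E)" and "(a, b) \<notin> E"
  shows "on_pairs cnot (insert (a, b) E) = on_pairs cnot {(a, b)} ** on_pairs cnot E"
proof -
  have inj: "inj_on snd (insert (a, b) E)" and disj: "fst ` insert (a, b) E \<inter> snd ` insert (a, b) E = {}"
    using assms(1) by (auto simp: disjoint_pairs_def)
  have E: "disjoint_pairs E"
    using assms(1) by (auto simp: disjoint_pairs_def)
  have "a \<noteq> b"
    using disj by auto
  have a: "(c, a) \<notin> E" for c
    using disj by force
  have b: "(c, b) \<notin> E" for c
    using inj_onD[OF inj, of "(c, b)" "(a, b)"] assms(2) by auto
  have "(y r \<noteq> (\<exists>c. (c, r) \<in> insert (a, b) E \<and> y c))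
      = flip_target a b (\<lambda>r. y r \<noteq> (\<exists>c. (c, r) \<in> E \<and> y c)) r" for y r
    using a b \<open>a \<noteq> b\<close> by (cases "r = b") auto
  then show ?thesis
    unfolding on_pairs_cnot_disjoint[OF assms(1)] on_pairs_cnot_disjoint[OF E]
      on_pairs_cnot[OF \<open>a \<noteq> b\<close>] perm_op_mult comp_def by presburger
qed

lemma on_pairs_empty: "on_pairs F {} = mat 1"
  by (simp add: vec_eq_iff on_pairs_def mat_def prod_of_bool fun_eq_iff flip: of_bool_def)

section \<open>Identities for S and H\<close>

lemma on_qubit_phase: "on_qubit (phase_pow 1) q = diag_op (\<lambda>x. if x q then \<i> else 1)"
  by (auto simp: vec_eq_iff on_qubit_nth phase_pow_def diag_op_def fun_eq_iff)

lemma sqrt2_sqrt2: "complex_of_real (sqrt 2) * complex_of_real (sqrt 2) = 2"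
  by (simp flip: of_real_mult)

lemma hadamard_hadamard: "hadamard ** hadamard = mat 1"
  by (simp add: vec_eq_iff matrix_matrix_mult_def hadamard_def mat_def UNIV_bool all_bool_eq sqrt2_sqrt2)

lemma dagger_hadamard [simp]: "dagger hadamard = hadamard"
  by (simp add: vec_eq_iff hadamard_def)

lemma hadamard_cz_hadamard:
  assumes "a \<noteq> b"
  shows "on_qubit hadamard b ** on_pairs cz {(a, b)} ** on_qubit hadamard b = on_pairs cnot {(a, b)}"
proof -
  have "(on_qubit hadamard b ** on_pairs cz {(a, b)} ** on_qubit hadamard b) $ x $ y
      = on_pairs cnot {(a, b)} $ x $ y" for x y
  proof -
    \<comment> \<open>Changing the bit at \<open>b\<close> does not affect agreement off
      \<open>a\<close> and \<open>b\<close>. All four terms of the double expansion thus share one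
      side condition, and only the bits at \<open>a\<close> and \<open>b\<close> remain to be
      checked.\<close>
    have off: "(\<forall>r. r \<noteq> a \<and> r \<noteq> b \<longrightarrow> (x(b := u)) r = (y(b := v)) r)
        \<longleftrightarrow> (\<forall>r. r \<noteq> a \<and> r \<noteq> b \<longrightarrow> x r = y r)" for u v
      by auto
    have upd: "(x(b := u)) a = x a" "(x(b := u)) b = u" "(y(b := u)) a = y a" "(y(b := u)) b = u" for u
      using assms by auto
    show ?thesis
      unfolding on_qubit_mult_nth mult_on_qubit_nth on_pairs_single_nth[OF assms] off upd
      by (cases "x a"; cases "x b"; cases "y a"; cases "y b")
        (auto simp add: cz_def cnot_def hadamard_def sqrt2_sqrt2)
  qed
  then show ?thesis
    by (simp add: vec_eq_iff)
qed

lemma hadamard_cnot_hadamard: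
  assumes "a \<noteq> b"
  shows "on_qubit hadamard b ** on_pairs cnot {(a, b)} ** on_qubit hadamard b = on_pairs cz {(a, b)}"
proof -
  have HH: "on_qubit hadamard b ** on_qubit hadamard b = mat 1"
    by (simp add: on_qubit_mult hadamard_hadamard)
  have "on_qubit hadamard b ** (on_qubit hadamard b ** on_pairs cz {(a, b)} ** on_qubit hadamard b)
      ** on_qubit hadamard b
    = (on_qubit hadamard b ** on_qubit hadamard b) ** on_pairs cz {(a, b)}
      ** (on_qubit hadamard b ** on_qubit hadamard b)"
    by (simp add: matrix_mul_assoc)
  then show ?thesis
    by (simp add: HH hadamard_cz_hadamard[OF assms])
qed

section \<open>Pauli and Clifford groups\<close>

text \<open>Multiplication modulo phases, that is, the Klein four-group; the phase is kept apart in
  \<open>pauli_phase\<close>.\<close>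

fun pauli_mult :: "pauli \<Rightarrow> pauli \<Rightarrow> pauli" where
  "pauli_mult PI Q = Q"
| "pauli_mult P PI = P"
| "pauli_mult PX PX = PI" | "pauli_mult PX PY = PZ" | "pauli_mult PX PZ = PY"
| "pauli_mult PY PX = PZ" | "pauli_mult PY PY = PI" | "pauli_mult PY PZ = PX"
| "pauli_mult PZ PX = PY" | "pauli_mult PZ PY = PX" | "pauli_mult PZ PZ = PI"

text \<open>An exponent of \<open>\<i>\<close>, with 3 standing for the phase \<open>- \<i>\<close>;
  natural exponents add up over the qubits of a string.\<close>

definition pauli_phase :: "pauli \<Rightarrow> pauli \<Rightarrow> nat" where
  "pauli_phase P Q = (if P = PI \<or> Q = PI \<or> P = Q then 0
     else if (P, Q) \<in> {(PX, PY), (PY, PZ), (PZ, PX)} then 1 else 3)"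

definition pauli_sign :: "pauli \<Rightarrow> pauli \<Rightarrow> complex" where
  "pauli_sign P Q = (if P = PI \<or> Q = PI \<or> P = Q then 1 else - 1)"

lemma pauli_mult_PI [simp]: "pauli_mult P PI = P"
  by (cases P) auto

lemma pauli_mult_self [simp]: "pauli_mult P P = PI"
  by (cases P) auto

lemma pauli_mult_cancel_left [simp]: "pauli_mult P (pauli_mult P Q) = Q"
  by (cases P; cases Q) auto

lemma pauli_sign_PI [simp]: "pauli_sign PI Q = 1" "pauli_sign P PI = 1"
  by (auto simp: pauli_sign_def)

lemma pauli_sign_self [simp]: "pauli_sign P P = 1"
  by (auto simp: pauli_sign_def)

text \<open>If \<open>P\<close> is not the identity, such an \<open>A\<close> anticommutes with
  it.\<close>

lemma ex_pauli_other: "\<exists>A. A \<noteq> PI \<and> A \<noteq> P"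
  by (cases P) (metis pauli.distinct)+

lemma pauli_gate_mult:
  "pauli_gate P ** pauli_gate Q = \<i> ^ pauli_phase P Q *\<^sub>c pauli_gate (pauli_mult P Q)"
  by (cases P; cases Q)
    (simp_all add: pauli_phase_def vec_eq_iff matrix_matrix_mult_def mat_def UNIV_bool all_bool_eq
      numeral_3_eq_3)

lemma pauli_gate_commute:
  "pauli_gate P ** pauli_gate Q = pauli_sign P Q *\<^sub>c (pauli_gate Q ** pauli_gate P)"
  by (cases P; cases Q)
    (simp_all add: pauli_sign_def vec_eq_iff matrix_matrix_mult_def mat_def UNIV_bool all_bool_eq)

lemma dagger_pauli_gate: "dagger (pauli_gate P) = pauli_gate P"
  by (cases P) (simp_all add: vec_eq_iff)

lemma pauli_string_mult:
  "pauli_string P ** pauli_string Q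
    = \<i> ^ (\<Sum>q\<in>UNIV. pauli_phase (P q) (Q q)) *\<^sub>c pauli_string (\<lambda>q. pauli_mult (P q) (Q q))"
  by (simp add: pauli_string_def tensor_mult pauli_gate_mult tensor_cscale power_sum)

text \<open>The symplectic form on Pauli strings in multiplicative notation: 1 for commuting strings
  and -1 for anticommuting ones.\<close>

definition string_sign :: "('q::finite \<Rightarrow> pauli) \<Rightarrow> ('q \<Rightarrow> pauli) \<Rightarrow> complex" where
  "string_sign P Q = (\<Prod>q\<in>UNIV. pauli_sign (P q) (Q q))"

lemma pauli_string_commute:
  "pauli_string P ** pauli_string Q = string_sign P Q *\<^sub>c (pauli_string Q ** pauli_string P)"
proof -
  have "pauli_string P ** pauli_string Q
      = tensor (\<lambda>q. pauli_sign (P q) (Q q) *\<^sub>c (pauli_gate (Q q) ** pauli_gate (P q)))"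
    by (simp only: pauli_string_def tensor_mult pauli_gate_commute[symmetric])
  then show ?thesis
    by (simp add: pauli_string_def tensor_mult tensor_cscale string_sign_def)
qed

lemma string_sign_cases: "string_sign P Q = 1 \<or> string_sign P Q = -1"
proof -
  have "(\<Prod>q\<in>A. pauli_sign (P q) (Q q)) \<in> {1, -1}" for A
    by (induction A rule: infinite_finite_induct) (auto simp: pauli_sign_def)
  then show ?thesis
    by (auto simp: string_sign_def)
qed

lemma string_sign_except:
  assumes "\<And>r. r \<noteq> q \<Longrightarrow> pauli_sign (P r) (Q r) = 1"
  shows "string_sign P Q = pauli_sign (P q) (Q q)"
  unfolding string_sign_def using assms by (rule prod_fun_except)

lemma pauli_string_PI [simp]: "pauli_string (\<lambda>_. PI) = mat 1"
  by (simp add: pauli_string_def)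

lemma pauli_string_square [simp]: "pauli_string P ** pauli_string P = mat 1"
  by (simp add: pauli_string_mult pauli_phase_def)

lemma dagger_pauli_string [simp]: "dagger (pauli_string P) = pauli_string P"
  by (simp add: pauli_string_def dagger_tensor dagger_pauli_gate)

lemma pauli_string_unitary: "pauli_string P \<in> unitaries"
  by (rule unitariesI) simp

lemma pauli_string_upd: "pauli_string ((\<lambda>_. PI)(q := A)) = on_qubit (pauli_gate A) q"
  by (auto simp: pauli_string_def on_qubit_def intro!: arg_cong[of _ _ tensor])

section \<open>The Pauli group\<close>

lemma pauli_group_iff: "M \<in> pauli_group \<longleftrightarrow> (\<exists>c P. M = \<i> ^ c *\<^sub>c pauli_string P)"
  by (auto simp: pauli_group_def)

lemma pauli_groupI: "\<i> ^ c *\<^sub>c pauli_string P \<in> pauli_group"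
  by (auto simp: pauli_group_iff)

lemma pauli_string_in_pauli_group [simp]: "pauli_string P \<in> pauli_group"
  using pauli_groupI[of 0] by simp

lemma cscale_pauli_group: "M \<in> pauli_group \<Longrightarrow> \<i> ^ c *\<^sub>c M \<in> pauli_group"
  unfolding pauli_group_iff by (metis cscale_cscale power_add)

lemma pauli_group_mult:
  assumes "M \<in> pauli_group" "N \<in> pauli_group"
  shows "M ** N \<in> pauli_group"
proof -
  obtain c d P Q where "M = \<i> ^ c *\<^sub>c pauli_string P" "N = \<i> ^ d *\<^sub>c pauli_string Q"
    using assms by (auto simp: pauli_group_iff)
  then have "M ** N = \<i> ^ (c + d + (\<Sum>q\<in>UNIV. pauli_phase (P q) (Q q)))
      *\<^sub>c pauli_string (\<lambda>q. pauli_mult (P q) (Q q))"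
    by (simp add: pauli_string_mult power_add mult_ac)
  then show ?thesis
    by (simp add: pauli_groupI)
qed

lemma pauli_group_unitary: "M \<in> pauli_group \<Longrightarrow> M \<in> unitaries"
  by (auto simp: pauli_group_iff norm_power intro!: unitaries_cscale pauli_string_unitary)

lemma pauli_group_commute:
  assumes "M \<in> pauli_group" "N \<in> pauli_group"
  shows "M ** N = N ** M \<or> M ** N = - (N ** M)"
proof -
  obtain c d P Q where MN: "M = \<i> ^ c *\<^sub>c pauli_string P" "N = \<i> ^ d *\<^sub>c pauli_string Q"
    using assms by (auto simp: pauli_group_iff)
  show ?thesis
    using string_sign_cases[of P Q] by (auto simp: MN pauli_string_commute[of P Q] mult_ac)
qed

lemma mat_eq_iff: "(mat a :: complex^'a::finite^'a) = mat b \<longleftrightarrow> a = b"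
  by (auto simp: vec_eq_iff mat_def)

lemma minus_mat_one: "- (mat 1 :: complex^'a::finite^'a) = mat (-1)"
  by (simp add: vec_eq_iff mat_def)

text \<open>Pauli strings square to the identity, so the phase \<open>\<i> ^ c\<close> itself
  squares to 1.\<close>

lemma pauli_involution_cases:
  assumes "M \<in> pauli_group" "M ** M = mat 1"
  obtains s P where "s = 1 \<or> s = -1" "M = s *\<^sub>c pauli_string P"
proof -
  obtain c P where M: "M = \<i> ^ c *\<^sub>c pauli_string P"
    using assms(1) by (auto simp: pauli_group_iff)
  with assms(2) have "(\<i> ^ c)\<^sup>2 = 1"
    by (simp add: mat_eq_iff power2_eq_square)
  with M that show ?thesis
    by (auto simp: power2_eq_1_iff)
qed

lemma pauli_anti_involution_cases:
  assumes "M \<in> pauli_group" "M ** M = - mat 1"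
  obtains s P where "s = \<i> \<or> s = - \<i>" "M = s *\<^sub>c pauli_string P"
proof -
  obtain c P where M: "M = \<i> ^ c *\<^sub>c pauli_string P"
    using assms(1) by (auto simp: pauli_group_iff)
  with assms(2) have "(\<i> ^ c)\<^sup>2 = \<i>\<^sup>2"
    by (simp add: minus_mat_one mat_eq_iff power2_eq_square)
  with M that show ?thesis
    by (metis power2_eq_iff)
qed

text \<open>There are finitely many strings, and the phase depends only on the exponent modulo 4.
  Finiteness is what makes inverses of Clifford operators Clifford.\<close>

lemma finite_pauli_group: "finite (pauli_group :: 'q::finite operator set)"
proof -
  have "UNIV = {PI, PX, PY, PZ}"
    using pauli.exhaust by blast
  then have fin: "finite (UNIV :: pauli set)"
    by (metis finite.emptyI finite.insertI)
  have "finite (UNIV :: ('q \<Rightarrow> pauli) set)"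
    using finite_PiE[of "UNIV :: 'q set" "\<lambda>_. UNIV :: pauli set"] fin by simp
  moreover have "\<i> ^ c = \<i> ^ (c mod 4)" for c
  proof -
    have "\<i> ^ c = (\<i> ^ 4) ^ (c div 4) * \<i> ^ (c mod 4)"
      by (metis mult_div_mod_eq power_add power_mult)
    then show ?thesis
      by (simp add: power4_eq_xxxx)
  qed
  then have "pauli_group \<subseteq> (\<lambda>(c, P). \<i> ^ c *\<^sub>c pauli_string P) ` ({..<4} \<times> (UNIV :: ('q \<Rightarrow> pauli) set))"
    by (auto simp: pauli_group_iff image_iff intro!: bexI[of _ "_ mod 4"]) force
  ultimately show ?thesis
    by (meson finite_SigmaI finite_imageI finite_lessThan finite_subset)
qed

section \<open>The Clifford group is a group\<close>

lemma clifford_group_unitary: "A \<in> clifford_group \<Longrightarrow> A \<in> unitaries"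
  by (simp add: clifford_group_def)

lemma clifford_groupD: "A \<in> clifford_group \<Longrightarrow> M \<in> pauli_group \<Longrightarrow> A ** M ** dagger A \<in> pauli_group"
  by (simp add: clifford_group_def)

lemma clifford_groupI:
  fixes A :: "'q::finite operator"
  assumes "A \<in> unitaries" and "\<And>P. A ** pauli_string P ** dagger A \<in> pauli_group"
  shows "A \<in> clifford_group"
  unfolding clifford_group_def
proof (safe intro!: assms(1))
  fix M :: "'q operator"
  assume "M \<in> pauli_group"
  then obtain c P where "M = \<i> ^ c *\<^sub>c pauli_string P"
    by (auto simp: pauli_group_iff)
  then show "A ** M ** dagger A \<in> pauli_group"
    using cscale_pauli_group[OF assms(2)] by simp
qed

lemma clifford_group_mult:
  assumes "A \<in> clifford_group" "B \<in> clifford_group"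
  shows "A ** B \<in> clifford_group"
proof -
  have "A ** B ** M ** dagger (A ** B) = A ** (B ** M ** dagger B) ** dagger A" for M
    by (simp add: matrix_mul_assoc)
  with assms show ?thesis
    by (simp add: clifford_group_def unitaries_mult)
qed

text \<open>Conjugation by \<open>A\<close> is an injective self-map of the finite Pauli group,
  hence onto, so the inverse conjugation preserves the Pauli group too.\<close>

lemma clifford_group_dagger:
  assumes "A \<in> clifford_group"
  shows "dagger A \<in> clifford_group"
proof -
  have U: "A \<in> unitaries"
    using assms by (rule clifford_group_unitary)
  have cancel: "dagger A ** (A ** M ** dagger A) ** A = M" for M
    by (simp add: unitariesD[OF U] flip: matrix_mul_assoc)
  have "inj_on (\<lambda>M. A ** M ** dagger A) pauli_group"
    by (rule inj_onI) (metis cancel)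
  moreover have "(\<lambda>M. A ** M ** dagger A) ` pauli_group \<subseteq> pauli_group"
    using assms by (auto intro: clifford_groupD)
  ultimately have "(\<lambda>M. A ** M ** dagger A) ` pauli_group = pauli_group"
    using endo_inj_surj finite_pauli_group by blast
  then have "dagger A ** M ** A \<in> pauli_group" if "M \<in> pauli_group" for M
    using that cancel by (metis (no_types, lifting) image_iff)
  with U show ?thesis
    by (simp add: clifford_group_def unitaries_dagger)
qed

lemma cscale_clifford_group:
  assumes "cmod \<omega> = 1" "A \<in> clifford_group"
  shows "\<omega> *\<^sub>c A \<in> clifford_group"
  using assms by (simp add: clifford_group_def unitaries_cscale cnj_mult_self_eq_1)

lemma subgroup_clifford_group: "subgroup clifford_group unitary_group"
proof (rule group.subgroupI[OF group_unitary_group])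
  have "mat 1 \<in> clifford_group"
    by (simp add: clifford_group_def unitaries_mat)
  then show "clifford_group \<noteq> {}"
    by blast
next
  fix A :: "'a operator"
  assume "A \<in> clifford_group"
  then show "inv\<^bsub>unitary_group\<^esub> A \<in> clifford_group"
    by (simp add: inv_unitary_group clifford_group_unitary clifford_group_dagger)
qed (auto simp: unitary_group_def clifford_group_unitary clifford_group_mult)

section \<open>The listed gates are Clifford\<close>

text \<open>The Clifford condition for 2 by 2 matrices, which are not themselves operators on a
  register and so cannot be members of \<open>clifford_group\<close>.\<close>

definition clifford_gate :: "gate1 \<Rightarrow> bool" where
  "clifford_gate G \<longleftrightarrow> G \<in> unitaries \<and>
     (\<forall>P. \<exists>c Q. G ** pauli_gate P ** dagger G = \<i> ^ c *\<^sub>c pauli_gate Q)"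

text \<open>Conjugation acts factor by factor, and the exponents of the local phases add up.\<close>

lemma tensor_clifford:
  assumes "\<And>q. clifford_gate (A q)"
  shows "tensor A \<in> clifford_group"
proof (rule clifford_groupI)
  have "A q ** dagger (A q) = mat 1" for q
    using assms[of q] by (auto simp: clifford_gate_def unitariesD)
  then show "tensor A \<in> unitaries"
    by (intro unitariesI) (simp add: dagger_tensor tensor_mult)
next
  fix P
  have "\<exists>c Q. A q ** pauli_gate (P q) ** dagger (A q) = \<i> ^ c *\<^sub>c pauli_gate Q" for q
    using assms[of q] by (simp add: clifford_gate_def)
  then obtain c Q where cQ: "A q ** pauli_gate (P q) ** dagger (A q) = \<i> ^ c q *\<^sub>c pauli_gate (Q q)" for q
    by metis
  have "tensor A ** pauli_string P ** dagger (tensor A) = \<i> ^ (\<Sum>q\<in>UNIV. c q) *\<^sub>c pauli_string Q"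
    by (simp add: pauli_string_def dagger_tensor tensor_mult cQ tensor_cscale power_sum)
  then show "tensor A ** pauli_string P ** dagger (tensor A) \<in> pauli_group"
    by (simp add: pauli_groupI)
qed

lemma clifford_gate_one: "clifford_gate (mat 1)"
  unfolding clifford_gate_def
proof (intro conjI allI)
  show "\<exists>c Q. mat 1 ** pauli_gate P ** dagger (mat 1) = \<i> ^ c *\<^sub>c pauli_gate Q" for P
    by (intro exI[of _ 0] exI[of _ P]) simp
qed (simp add: unitaries_mat)

lemma clifford_gate_hadamard: "clifford_gate hadamard"
  unfolding clifford_gate_def
proof (intro conjI allI)
  fix P
  have "hadamard ** pauli_gate PI ** dagger hadamard = \<i> ^ 0 *\<^sub>c pauli_gate PI"
    by (simp add: hadamard_hadamard)
  moreover have "hadamard ** pauli_gate PX ** dagger hadamard = \<i> ^ 0 *\<^sub>c pauli_gate PZ"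
    "hadamard ** pauli_gate PY ** dagger hadamard = \<i> ^ 2 *\<^sub>c pauli_gate PY"
    "hadamard ** pauli_gate PZ ** dagger hadamard = \<i> ^ 0 *\<^sub>c pauli_gate PX"
    by (simp_all add: vec_eq_iff matrix_matrix_mult_def UNIV_bool all_bool_eq hadamard_def sqrt2_sqrt2)
  ultimately show "\<exists>c Q. hadamard ** pauli_gate P ** dagger hadamard = \<i> ^ c *\<^sub>c pauli_gate Q"
    by (cases P) blast+
qed (simp add: unitariesI hadamard_hadamard)

lemma phase_pow_eq: "phase_pow 1 = diag_op (\<lambda>x. if x then \<i> else 1)"
  "phase_pow (-1) = diag_op (\<lambda>x. if x then - \<i> else 1)"
  by (simp_all add: vec_eq_iff phase_pow_def diag_op_def power_int_minus)

lemma clifford_gate_phase: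
  assumes "a \<in> {1, -1}"
  shows "clifford_gate (phase_pow a)"
  unfolding clifford_gate_def
proof (intro conjI allI)
  show "phase_pow a \<in> unitaries"
    using assms by (intro unitariesI)
      (auto simp: phase_pow_eq dagger_diag_op diag_op_mult diag_op_one[symmetric] fun_eq_iff
        intro!: arg_cong[of _ _ diag_op])
  fix P
  \<comment> \<open>The exponent 2 is a minus sign: S maps X to Y and Y to -X, and its inverse maps
    X to -Y and Y to X.\<close>
  have "phase_pow a ** pauli_gate PI ** dagger (phase_pow a) = \<i> ^ 0 *\<^sub>c pauli_gate PI"
    "phase_pow a ** pauli_gate PX ** dagger (phase_pow a) = \<i> ^ (if a = 1 then 0 else 2) *\<^sub>c pauli_gate PY"
    "phase_pow a ** pauli_gate PY ** dagger (phase_pow a) = \<i> ^ (if a = 1 then 2 else 0) *\<^sub>c pauli_gate PX"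
    "phase_pow a ** pauli_gate PZ ** dagger (phase_pow a) = \<i> ^ 0 *\<^sub>c pauli_gate PZ"
    using assms
    by (auto simp: vec_eq_iff matrix_matrix_mult_def UNIV_bool all_bool_eq phase_pow_eq diag_op_nth mat_def)
  then show "\<exists>c Q. phase_pow a ** pauli_gate P ** dagger (phase_pow a) = \<i> ^ c *\<^sub>c pauli_gate Q"
    by (cases P) blast+
qed

lemma on_qubit_clifford: "clifford_gate G \<Longrightarrow> on_qubit G q \<in> clifford_group"
  unfolding on_qubit_def by (rule tensor_clifford) (simp add: clifford_gate_one)

text \<open>\<open>cnot_pauli P Q = (c, P', Q')\<close> encodes CNOT (P \<otimes> Q) CNOT = \<open>\<i>\<^sup>c\<close> P' \<otimes> Q', with the control
  qubit first.\<close>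

fun cnot_pauli :: "pauli \<Rightarrow> pauli \<Rightarrow> nat \<times> pauli \<times> pauli" where
  "cnot_pauli PI PI = (0, PI, PI)" | "cnot_pauli PI PX = (0, PI, PX)"
| "cnot_pauli PI PY = (0, PZ, PY)" | "cnot_pauli PI PZ = (0, PZ, PZ)"
| "cnot_pauli PX PI = (0, PX, PX)" | "cnot_pauli PX PX = (0, PX, PI)"
| "cnot_pauli PX PY = (0, PY, PZ)" | "cnot_pauli PX PZ = (2, PY, PY)"
| "cnot_pauli PY PI = (0, PY, PX)" | "cnot_pauli PY PX = (0, PY, PI)"
| "cnot_pauli PY PY = (2, PX, PZ)" | "cnot_pauli PY PZ = (0, PX, PY)"
| "cnot_pauli PZ PI = (0, PZ, PI)" | "cnot_pauli PZ PX = (0, PZ, PX)"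
| "cnot_pauli PZ PY = (0, PI, PY)" | "cnot_pauli PZ PZ = (0, PI, PZ)"

text \<open>CNOT permutes basis states, so conjugating by it replaces the target bits
  \<open>u'\<close> and \<open>v'\<close> of an entry by their sums with the control bits
  \<open>u\<close> and \<open>v\<close>.\<close>

lemma cnot_pauli:
  assumes "cnot_pauli P Q = (c, P', Q')"
  shows "pauli_gate P $ u $ v * pauli_gate Q $ (u' \<noteq> u) $ (v' \<noteq> v)
    = \<i> ^ c * (pauli_gate P' $ u $ v * pauli_gate Q' $ u' $ v')"
  using assms
  by (cases P; cases Q; cases u; cases v; cases u'; cases v') (auto simp: mat_def)

lemma prod_two:
  fixes f :: "'q::finite \<Rightarrow> 'c::comm_monoid_mult"
  assumes "a \<noteq> b"
  shows "(\<Prod>q\<in>UNIV. f q) = f a * f b * (\<Prod>q\<in>- {a, b}. f q)"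
proof -
  have "(\<Prod>q\<in>UNIV. f q) = (\<Prod>q\<in>{a, b} \<union> - {a, b}. f q)"
    by simp
  then show ?thesis
    using assms by (subst (asm) prod.union_disjoint) auto
qed

lemma flip_target_involution: "a \<noteq> b \<Longrightarrow> flip_target a b (flip_target a b x) = x"
  by (rule ext) auto

lemma on_pairs_cnot_clifford:
  assumes "a \<noteq> b"
  shows "on_pairs cnot {(a, b)} \<in> clifford_group"
proof (rule clifford_groupI)
  note inv = flip_target_involution[OF assms]
  note dag = dagger_perm_op[of "flip_target a b", OF inv]
  show "on_pairs cnot {(a, b)} \<in> unitaries"
    by (rule unitariesI) (simp only: on_pairs_cnot[OF assms] dag perm_op_mult comp_def inv perm_op_id)
  fix P
  obtain c P' Q' where cPQ: "cnot_pauli (P a) (P b) = (c, P', Q')"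
    by (metis prod_cases3)
  have "pauli_string P $ flip_target a b x $ flip_target a b y
      = (\<i> ^ c *\<^sub>c pauli_string (P(a := P', b := Q'))) $ x $ y" for x y
    using assms cnot_pauli[OF cPQ, of "x a" "y a" "x b" "y b"]
    by (simp add: pauli_string_def tensor_nth prod_two[OF assms] mult.assoc[symmetric])
  then have "on_pairs cnot {(a, b)} ** pauli_string P ** dagger (on_pairs cnot {(a, b)})
      = \<i> ^ c *\<^sub>c pauli_string (P(a := P', b := Q'))"
    by (simp only: on_pairs_cnot[OF assms] dag vec_eq_iff mult_perm_op_nth perm_op_mult_nth[of "flip_target a b", OF inv])
      simp
  then show "on_pairs cnot {(a, b)} ** pauli_string P ** dagger (on_pairs cnot {(a, b)}) \<in> pauli_group"
    by (simp add: pauli_groupI)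
qed

lemma on_pairs_cnot_disjoint_clifford: "disjoint_pairs E \<Longrightarrow> on_pairs cnot E \<in> clifford_group"
proof (induction E rule: infinite_finite_induct)
  case (insert e E)
  obtain a b where e: "e = (a, b)"
    by fastforce
  have "disjoint_pairs E" "a \<noteq> b"
    using insert.prems by (auto simp: disjoint_pairs_def e)
  with insert show ?case
    by (simp add: e on_pairs_cnot_insert clifford_group_mult on_pairs_cnot_clifford)
qed (use subgroup.one_closed[OF subgroup_clifford_group] in \<open>auto simp: on_pairs_empty unitary_group_def\<close>)

lemma on_pairs_cz_clifford:
  assumes "a \<noteq> b"
  shows "on_pairs cz {(a, b)} \<in> clifford_group"
  unfolding hadamard_cnot_hadamard[OF assms, symmetric]
  by (simp add: clifford_group_mult on_qubit_clifford clifford_gate_hadamard on_pairs_cnot_clifford assms)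

section \<open>Pauli rotations\<close>

abbreviation site :: "'q \<Rightarrow> pauli \<Rightarrow> 'q::finite operator" where
  "site q A \<equiv> pauli_string ((\<lambda>_. PI)(q := A))"

text \<open>For an anti-involutive Pauli operator \<open>R\<close> this is \<open>exp (\<pi> R / 4)\<close>, a Clifford operator that
  acts on the Pauli group as a symplectic transvection.\<close>

definition rot :: "complex^'a::finite^'a \<Rightarrow> complex^'a^'a" where
  "rot R = complex_of_real (1 / sqrt 2) *\<^sub>c (mat 1 + R)"

lemma matrix_add_rdistrib: "(A + B) ** C = A ** C + B ** C"
  for A :: "complex^'a::finite^'b::finite" and C :: "complex^'c::finite^'a"
  by (simp add: vec_eq_iff matrix_matrix_mult_def sum.distrib distrib_right)

lemma inv_sqrt2_mult: "complex_of_real (1 / sqrt 2) * complex_of_real (1 / sqrt 2) = 1 / 2"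
  by (simp flip: of_real_mult)

lemma rot_mult: "rot R ** M ** rot R' = (1 / 2) *\<^sub>c ((mat 1 + R) ** M ** (mat 1 + R'))"
  unfolding rot_def cscale_mult_left cscale_mult_right cscale_cscale inv_sqrt2_mult ..

lemma conj_rot:
  assumes "U \<in> unitaries"
  shows "U ** rot R ** dagger U = rot (U ** R ** dagger U)"
  using unitariesD(2)[OF assms] by (simp add: rot_def matrix_add_ldistrib matrix_add_rdistrib cscale_add_right)

lemma dagger_rot: "dagger (rot R) = rot (dagger R)"
  by (simp add: rot_def)

lemma half_double: "(1 / 2) *\<^sub>c (A + A) = A"
  by (simp add: vec_eq_iff)

text \<open>Both sides are the inverse of \<open>R\<close>.\<close>

lemma dagger_anti_involution:
  assumes "R \<in> unitaries" "R ** R = - mat 1"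
  shows "dagger R = - R"
proof -
  have "dagger R ** (R ** R) = R"
    using unitariesD(3)[OF assms(1)] .
  then have "- dagger R = R"
    by (simp add: assms(2))
  then show ?thesis
    by (metis minus_minus)
qed

lemma rot_unitary:
  assumes "R \<in> unitaries" "R ** R = - mat 1"
  shows "rot R \<in> unitaries"
proof (rule unitariesI)
  have "rot R ** dagger (rot R) = rot R ** mat 1 ** rot (- R)"
    by (simp only: dagger_rot dagger_anti_involution[OF assms] matrix_mul_rid)
  also have "\<dots> = (1 / 2) *\<^sub>c (mat 1 + mat 1)"
    unfolding rot_mult
    unfolding matrix_add_ldistrib matrix_add_rdistrib matrix_mult_minus_right matrix_mul_lid matrix_mul_rid assms(2) by simp
  finally show "rot R ** dagger (rot R) = mat 1"
    by (simp only: half_double)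
qed

lemma rot_commute: "R ** M = M ** R \<Longrightarrow> rot R ** M = M ** rot R"
  by (simp add: rot_def matrix_add_ldistrib matrix_add_rdistrib)

text \<open>In the expansion of \<open>(1 + R) M (1 - R)\<close> the terms \<open>M\<close> and
  \<open>- R M R\<close> cancel, as anticommutation gives \<open>R M R = M\<close>; the rest,
  \<open>R M - M R\<close>, is twice \<open>R M\<close>.\<close>

lemma rot_conj_anticommute:
  assumes "R \<in> unitaries" "R ** R = - mat 1" "R ** M = - (M ** R)"
  shows "rot R ** M ** dagger (rot R) = R ** M"
proof -
  have "R ** M ** R = M"
    using assms(2) by (simp add: assms(3) flip: matrix_mul_assoc)
  moreover have "M ** R = - (R ** M)"
    using assms(3) by simp
  ultimately have "(mat 1 + R) ** M ** (mat 1 + - R) = R ** M + R ** M"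
    unfolding matrix_add_ldistrib matrix_add_rdistrib matrix_mult_minus_right matrix_mul_rid matrix_mul_lid
    by simp
  then show ?thesis
    by (simp only: dagger_rot dagger_anti_involution[OF assms(1,2)] rot_mult half_double)
qed

lemma rot_clifford:
  assumes "R \<in> pauli_group" "R ** R = - mat 1"
  shows "rot R \<in> clifford_group"
proof (rule clifford_groupI)
  have U: "R \<in> unitaries"
    using assms(1) by (rule pauli_group_unitary)
  then show rot: "rot R \<in> unitaries"
    using assms(2) by (rule rot_unitary)
  fix P
  consider "R ** pauli_string P = pauli_string P ** R" | "R ** pauli_string P = - (pauli_string P ** R)"
    using pauli_group_commute[OF assms(1)] pauli_string_in_pauli_group by blast
  then show "rot R ** pauli_string P ** dagger (rot R) \<in> pauli_group"
  proof cases
    case 1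
    then have "rot R ** pauli_string P ** dagger (rot R) = pauli_string P ** (rot R ** dagger (rot R))"
      by (simp only: rot_commute matrix_mul_assoc)
    then show ?thesis
      by (simp add: unitariesD[OF rot])
  next
    case 2
    then show ?thesis
      using rot_conj_anticommute[OF U assms(2)] pauli_group_mult[OF assms(1) pauli_string_in_pauli_group]
      by metis
  qed
qed

text \<open>The product would equal its own negative and vanish, although it is invertible.\<close>

lemma not_commute_and_anticommute:
  fixes M N :: "complex^'a::finite^'a"
  assumes "M \<in> unitaries" "N \<in> unitaries" "M ** N = N ** M" "M ** N = - (N ** M)"
  shows False
proof -
  have "M ** N = - (M ** N)"
    using assms(3,4) by simp
  then have "(M ** N) $ i $ j = 0" for i j
    using arg_cong[OF \<open>M ** N = - (M ** N)\<close>, of "\<lambda>A. A $ i $ j"]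
    by (simp add: complex_eq_iff)
  then have "M ** N = 0"
    by (simp add: vec_eq_iff)
  then have "mat 1 = (0 :: complex^'a^'a)"
    using unitariesD(1)[OF unitaries_mult[OF assms(1,2)]] by simp
  then have "(mat 1 :: complex^'a^'a) $ undefined $ undefined = 0"
    by simp
  then show False
    by (simp add: mat_def)
qed

lemma on_qubit_PZ: "on_qubit (pauli_gate PZ) q = diag_op (\<lambda>x. if x q then -1 else 1)"
  by (auto simp: vec_eq_iff on_qubit_nth diag_op_nth fun_eq_iff)

lemma on_qubit_PX: "on_qubit (pauli_gate PX) q = perm_op (\<lambda>x. x(q := \<not> x q))"
  by (auto simp: vec_eq_iff on_qubit_nth perm_op_def fun_eq_iff split: if_splits)

lemma site_Z_Z:
  assumes "q \<noteq> r"
  shows "pauli_string ((\<lambda>_. PI)(q := PZ, r := PZ)) = diag_op (\<lambda>x. if x q = x r then 1 else -1)"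
proof -
  have "site q PZ ** site r PZ = \<i> ^ 0 *\<^sub>c pauli_string ((\<lambda>_. PI)(q := PZ, r := PZ))"
    unfolding pauli_string_mult using assms
    by (intro arg_cong2[of _ _ _ _ "\<lambda>c P. \<i> ^ c *\<^sub>c pauli_string P"]) (auto simp: pauli_phase_def)
  moreover have "site q PZ ** site r PZ = diag_op (\<lambda>x. if x q = x r then 1 else -1)"
    unfolding pauli_string_upd on_qubit_PZ diag_op_mult by (rule arg_cong[of _ _ diag_op]) auto
  ultimately show ?thesis
    by simp
qed

text \<open>The number is a primitive eighth root of unity. It is the phase between
  \<open>rot\<close> and the inverse of S, and between \<open>S (H S H) S\<close> and H.\<close>

lemma cmod_eighth_root: "cmod (complex_of_real (1 / sqrt 2) * (1 + \<i>)) = 1"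
  by (simp add: norm_mult cmod_def power_divide)

section \<open>Pauli rotations in a group containing H, S and CNOT\<close>

text \<open>Since all global phases belong to \<open>G\<close>, identities up to phase yield
  membership.\<close>

locale phase_subgroup =
  fixes G :: "'q::finite operator set"
  assumes unitary: "A \<in> G \<Longrightarrow> A \<in> unitaries"
    and phase: "cmod \<omega> = 1 \<Longrightarrow> mat \<omega> \<in> G"
    and mult: "A \<in> G \<Longrightarrow> B \<in> G \<Longrightarrow> A ** B \<in> G"
    and dagger: "A \<in> G \<Longrightarrow> dagger A \<in> G"
begin

lemma cscale: "cmod \<omega> = 1 \<Longrightarrow> A \<in> G \<Longrightarrow> \<omega> *\<^sub>c A \<in> G"
  using mult[OF phase] by simp

end

locale clifford_generators = phase_subgroup G for G :: "'q::finite operator set" +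
  assumes hadamard_mem: "on_qubit hadamard q \<in> G"
    and phase_mem: "on_qubit (phase_pow 1) q \<in> G"
    and cnot_mem: "q \<noteq> r \<Longrightarrow> on_pairs cnot {(q, r)} \<in> G"
begin

text \<open>Fixing the factor \<open>\<i>\<close> loses nothing: the rotation with
  \<open>- \<i>\<close> is the adjoint.\<close>

definition rotatable :: "('q \<Rightarrow> pauli) \<Rightarrow> bool" where
  "rotatable P \<longleftrightarrow> rot (\<i> *\<^sub>c pauli_string P) \<in> G"

lemma rotatable_conj:
  assumes "rotatable P" "U \<in> G" "U ** pauli_string P ** dagger U = pauli_string Q"
  shows "rotatable Q"
  using mult[OF mult[OF assms(2) assms(1)[unfolded rotatable_def]] dagger[OF assms(2)]]
  by (simp add: conj_rot[OF unitary[OF assms(2)]] assms(3) rotatable_def)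

lemma rot_cscale_pauli_string:
  assumes "rotatable P" "s = \<i> \<or> s = - \<i>"
  shows "rot (s *\<^sub>c pauli_string P) \<in> G"
  using assms(2)
proof
  assume "s = - \<i>"
  then have "rot (s *\<^sub>c pauli_string P) = dagger (rot (\<i> *\<^sub>c pauli_string P))"
    by (simp add: dagger_rot)
  with assms(1) show ?thesis
    by (simp add: rotatable_def dagger)
qed (use assms(1) in \<open>simp add: rotatable_def\<close>)

lemma rotatable_if_anti_involution:
  assumes "rot (s *\<^sub>c pauli_string P) \<in> G" "s = \<i> \<or> s = - \<i>"
  shows "rotatable P"
  using assms(2)
proof
  assume "s = - \<i>"
  then have "rot (\<i> *\<^sub>c pauli_string P) = dagger (rot (s *\<^sub>c pauli_string P))"
    by (simp add: dagger_rot)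
  with assms(1) show ?thesis
    by (simp add: rotatable_def dagger)
qed (use assms(1) in \<open>simp add: rotatable_def\<close>)

text \<open>If \<open>R\<close> and \<open>R'\<close> anticommute, conjugating \<open>rot R'\<close> by \<open>rot R\<close> gives \<open>rot (R R')\<close>.\<close>

lemma rotatable_mult:
  assumes "rotatable P" "rotatable Q" "string_sign P Q = -1"
  shows "rotatable (\<lambda>q. pauli_mult (P q) (Q q))"
proof -
  define R where "R = \<i> *\<^sub>c pauli_string P"
  define R' where "R' = \<i> *\<^sub>c pauli_string Q"
  have R: "R \<in> unitaries" "R ** R = - mat 1" and R': "R' ** R' = - mat 1"
    by (simp_all add: R_def R'_def unitaries_cscale pauli_string_unitary minus_mat_one)
  have anti: "R ** R' = - (R' ** R)"
    by (simp add: R_def R'_def pauli_string_commute[of P Q] assms(3))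
  have "rot R ** rot R' ** dagger (rot R) = rot (R ** R')"
    by (simp add: conj_rot rot_unitary R rot_conj_anticommute anti)
  then have mem: "rot (R ** R') \<in> G"
    using assms(1,2) by (metis R_def R'_def rotatable_def mult dagger)
  define s where "s = \<i> * \<i> * \<i> ^ (\<Sum>q\<in>UNIV. pauli_phase (P q) (Q q))"
  have RR': "R ** R' = s *\<^sub>c pauli_string (\<lambda>q. pauli_mult (P q) (Q q))"
    by (simp add: R_def R'_def pauli_string_mult s_def)
  \<comment> \<open>The product of two anticommuting anti-involutions is again one, which forces its
    scalar \<open>s\<close> to be \<open>\<i>\<close> or \<open>- \<i>\<close>.\<close>
  have "R ** R' ** (R ** R') = R ** (R' ** R) ** R'"
    by (simp add: matrix_mul_assoc)
  also have "\<dots> = - (R ** R ** (R' ** R'))"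
    unfolding anti[symmetric, THEN arg_cong[of _ _ uminus], simplified] by (simp add: matrix_mul_assoc)
  also have "\<dots> = - mat 1"
    by (simp add: R R')
  finally have "s * s = -1"
    by (simp add: RR' minus_mat_one mat_eq_iff)
  then have "s\<^sup>2 = \<i>\<^sup>2"
    by (simp add: power2_eq_square)
  then have "s = \<i> \<or> s = - \<i>"
    by (simp only: power2_eq_iff)
  with mem show ?thesis
    unfolding RR' by (rule rotatable_if_anti_involution)
qed

lemma rotatable_PI: "rotatable (\<lambda>_. PI)"
proof -
  have "rot (\<i> *\<^sub>c pauli_string (\<lambda>_. PI)) = mat (complex_of_real (1 / sqrt 2) * (1 + \<i>))"
    by (simp add: rot_def vec_eq_iff mat_def)
  then show ?thesis
    unfolding rotatable_def using phase[OF cmod_eighth_root] by metis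
qed

lemma rotatable_site:
  assumes "A \<noteq> PI"
  shows "rotatable ((\<lambda>_. PI)(q := A))"
proof -
  \<comment> \<open>The diagonal entries \<open>1 + \<i>\<close> and \<open>1 - \<i>\<close> have
    quotient \<open>- \<i>\<close>, so up to phase this is the inverse of S. H then turns Z into X,
    and Y comes from the product of X and Z.\<close>
  have "rot (\<i> *\<^sub>c site q PZ)
      = (complex_of_real (1 / sqrt 2) * (1 + \<i>)) *\<^sub>c dagger (on_qubit (phase_pow 1) q)"
    unfolding pauli_string_upd on_qubit_PZ on_qubit_phase dagger_diag_op rot_def
      diag_op_one[symmetric] cscale_diag_op
    by (auto simp: vec_eq_iff diag_op_nth field_simps)
  then have Z: "rotatable ((\<lambda>_. PI)(q := PZ))"
    unfolding rotatable_def by (simp only: cscale cmod_eighth_root dagger phase_mem)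
  have HZH: "hadamard ** pauli_gate PZ ** hadamard = pauli_gate PX"
    by (simp add: vec_eq_iff matrix_matrix_mult_def UNIV_bool all_bool_eq hadamard_def sqrt2_sqrt2)
  have X: "rotatable ((\<lambda>_. PI)(q := PX))"
    by (rule rotatable_conj[OF Z hadamard_mem[of q]])
      (simp only: pauli_string_upd dagger_on_qubit on_qubit_mult dagger_hadamard HZH)
  have "string_sign ((\<lambda>_. PI)(q := PX)) ((\<lambda>_. PI)(q := PZ)) = -1"
    by (subst string_sign_except[of q]) (auto simp: pauli_sign_def)
  from rotatable_mult[OF X Z this]
  have "rotatable ((\<lambda>_. PI)(q := PY))"
    by (rule back_subst[of rotatable]) auto
  with X Z assms show ?thesis
    by (cases A) auto
qed

lemma rotatable_change_site:
  assumes "rotatable P" "P q \<noteq> PI" "A \<noteq> PI"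
  shows "rotatable (P(q := A))"
proof (cases "A = P q")
  case False
  \<comment> \<open>\<open>A\<close> and \<open>P q\<close> are distinct and nontrivial, so
    \<open>C\<close> is the third Pauli letter; it anticommutes with \<open>P q\<close> and
    multiplies it to \<open>A\<close>.\<close>
  define C where "C = pauli_mult A (P q)"
  have C: "C \<noteq> PI" "pauli_sign C (P q) = -1" "pauli_mult C (P q) = A"
    using assms(2,3) False by (cases A; cases "P q"; simp add: C_def pauli_sign_def)+
  have "string_sign ((\<lambda>_. PI)(q := C)) P = -1"
    by (subst string_sign_except[of q]) (auto simp: C)
  from rotatable_mult[OF rotatable_site[OF C(1)] assms(1) this]
  show ?thesis
    by (rule back_subst[of rotatable]) (auto simp: C)
qed (use assms in simp)

text \<open>Conjugation by a CNOT spreads Z on the target to Z on both qubits; the two letters are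
  then changed separately.\<close>

lemma rotatable_pair:
  assumes "q \<noteq> r" "A \<noteq> PI" "B \<noteq> PI"
  shows "rotatable ((\<lambda>_. PI)(q := A, r := B))"
proof -
  note inv = flip_target_involution[OF assms(1)]
  note dag = dagger_perm_op[of "flip_target q r", OF inv]
  have "on_pairs cnot {(q, r)} ** site r PZ ** dagger (on_pairs cnot {(q, r)})
      = diag_op (\<lambda>x. if flip_target q r x r then -1 else 1)"
    unfolding on_pairs_cnot[OF assms(1)] dag pauli_string_upd on_qubit_PZ by (rule perm_diag_perm) (rule inv)
  also have "\<dots> = pauli_string ((\<lambda>_. PI)(q := PZ, r := PZ))"
    unfolding site_Z_Z[OF assms(1)] by (rule arg_cong[of _ _ diag_op]) auto
  finally have "rotatable ((\<lambda>_. PI)(q := PZ, r := PZ))"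
    using rotatable_conj rotatable_site cnot_mem[OF assms(1)] by blast
  from rotatable_change_site[OF rotatable_change_site[OF this, of q A], of r B]
  have "rotatable ((\<lambda>_. PI)(q := PZ, r := PZ, q := A, r := B))"
    using assms by simp
  then show ?thesis
    using assms(1) by (simp add: fun_upd_twist)
qed

lemma rotatable_all: "rotatable P"
proof (induction P rule: measure_induct_rule[where f = weight])
  case (less P)
  consider "P = (\<lambda>_. PI)" | q where "P q \<noteq> PI" "\<And>r. r \<noteq> q \<Longrightarrow> P r = PI"
    | q r where "q \<noteq> r" "P q \<noteq> PI" "P r \<noteq> PI"
    by (metis ext)
  then show ?case
  proof cases
    case 1
    then show ?thesis
      by (simp add: rotatable_PI)
  next
    case 2
    then have "P = (\<lambda>_. PI)(q := P q)"
      by auto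
    with 2 rotatable_site[of "P q" q] show ?thesis
      by simp
  next
    case 3
    obtain A where A: "A \<noteq> PI" "A \<noteq> P q"
      using ex_pauli_other by metis
    \<comment> \<open>\<open>P\<close> is the product of the two-site string (\<open>A\<close> at
      \<open>q\<close>, \<open>P r\<close> at \<open>r\<close>) with \<open>Q\<close>. The letter of
      \<open>Q\<close> at \<open>q\<close> is the third Pauli, so the factors anticommute there and
      nowhere else, while erasing the letter at \<open>r\<close> lowers the weight.\<close>
    define Q where "Q = P(q := pauli_mult A (P q), r := PI)"
    have "{s. Q s \<noteq> PI} \<subset> {s. P s \<noteq> PI}"
      using 3 by (auto simp: Q_def)
    then have "weight Q < weight P"
      by (simp add: weight_def psubset_card_mono)
    then have Q: "rotatable Q"
      by (rule less)
    have "pauli_sign A (pauli_mult A (P q)) = -1"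
      using A 3 by (cases A; cases "P q") (auto simp: pauli_sign_def)
    then have "string_sign ((\<lambda>_. PI)(q := A, r := P r)) Q = -1"
      using 3 by (subst string_sign_except[of q]) (auto simp: Q_def)
    from rotatable_mult[OF rotatable_pair[OF 3(1) A(1) 3(3)] Q this]
    show ?thesis
      by (rule back_subst[of rotatable]) (use 3 in \<open>auto simp: Q_def\<close>)
  qed
qed

lemma rot_mem:
  assumes "R \<in> pauli_group" "R ** R = - mat 1"
  shows "rot R \<in> G"
  using pauli_anti_involution_cases[OF assms] rot_cscale_pauli_string[OF rotatable_all] by metis

end

section \<open>Reduction of Clifford operators\<close>

text \<open>Operators that leave the qubits in \<open>T\<close> untouched; the reduction enlarges
  \<open>T\<close> until only scalars remain.\<close>

definition site_centralizer :: "'q set \<Rightarrow> 'q::finite operator set" where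
  "site_centralizer T = {U. \<forall>q\<in>T. \<forall>A. U ** site q A = site q A ** U}"

lemma site_centralizerD: "U \<in> site_centralizer T \<Longrightarrow> q \<in> T \<Longrightarrow> U ** site q A = site q A ** U"
  by (simp add: site_centralizer_def)

lemma site_centralizer_mult:
  assumes "U \<in> site_centralizer T" "V \<in> site_centralizer T"
  shows "U ** V \<in> site_centralizer T"
  unfolding site_centralizer_def
proof (intro CollectI ballI allI)
  fix q A assume "q \<in> T"
  have "U ** V ** site q A = U ** (V ** site q A)"
    by (simp add: matrix_mul_assoc)
  also have "\<dots> = (U ** site q A) ** V"
    by (simp add: site_centralizerD[OF assms(2) \<open>q \<in> T\<close>] matrix_mul_assoc)
  also have "\<dots> = site q A ** (U ** V)"
    by (simp add: site_centralizerD[OF assms(1) \<open>q \<in> T\<close>] matrix_mul_assoc)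
  finally show "U ** V ** site q A = site q A ** (U ** V)" .
qed

lemma site_commute: "q \<noteq> r \<Longrightarrow> site q A ** site r B = site r B ** site q A"
  by (subst pauli_string_commute, subst string_sign_except[of q]) auto

lemma site_anticommute:
  assumes "A \<noteq> PI" "B \<noteq> PI" "A \<noteq> B"
  shows "site q A ** site q B = - (site q B ** site q A)"
  using assms by (subst pauli_string_commute, subst string_sign_except[of q]) (auto simp: pauli_sign_def)

lemma site_PY: "site q PY = \<i> *\<^sub>c (site q PX ** site q PZ)"
proof -
  have "site q PX ** site q PZ = \<i> ^ 3 *\<^sub>c site q PY"
    by (simp add: pauli_string_upd on_qubit_mult pauli_gate_mult on_qubit_cscale pauli_phase_def
        del: pauli_gate.simps)
  then show ?thesis
    by (simp add: numeral_3_eq_3)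
qed

lemma site_in_site_centralizer: "q \<notin> T \<Longrightarrow> site q A \<in> site_centralizer T"
  by (auto simp: site_centralizer_def intro!: site_commute)

lemma pauli_string_site_anticommute:
  assumes "P q \<noteq> PI" "A \<noteq> PI" "A \<noteq> P q"
  shows "pauli_string P ** site q A = - (site q A ** pauli_string P)"
  using assms by (subst pauli_string_commute, subst string_sign_except[of q]) (auto simp: pauli_sign_def)

text \<open>A nontrivial letter at \<open>q\<close> anticommutes with some Pauli operator on that
  qubit.\<close>

lemma pauli_string_PI_if_centralizer:
  assumes "pauli_string P \<in> site_centralizer T" "q \<in> T"
  shows "P q = PI"
proof (rule ccontr)
  assume "P q \<noteq> PI"
  moreover obtain A where "A \<noteq> PI" "A \<noteq> P q"
    using ex_pauli_other by metis
  ultimately have "pauli_string P ** site q A = - (site q A ** pauli_string P)"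
    by (intro pauli_string_site_anticommute)
  with site_centralizerD[OF assms] show False
    using not_commute_and_anticommute pauli_string_unitary by blast
qed

lemma cscale_site_centralizer_iff:
  "c \<noteq> 0 \<Longrightarrow> c *\<^sub>c U \<in> site_centralizer T \<longleftrightarrow> U \<in> site_centralizer T"
  by (simp add: site_centralizer_def vec_eq_iff)

lemma conj_mult:
  assumes "U \<in> unitaries"
  shows "(U ** M ** dagger U) ** (U ** N ** dagger U) = U ** (M ** N) ** dagger U"
proof -
  have "(U ** M ** dagger U) ** (U ** N ** dagger U) = U ** M ** (dagger U ** U) ** N ** dagger U"
    by (simp add: matrix_mul_assoc)
  then show ?thesis
    by (simp add: unitariesD[OF assms] matrix_mul_assoc)
qed

lemma conj_conj:
  "(g ** h) ** M ** dagger (g ** h) = g ** (h ** M ** dagger h) ** dagger g"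
  by (simp add: matrix_mul_assoc)

lemma conj_eq_iff_commute:
  assumes "U \<in> unitaries"
  shows "U ** M ** dagger U = M \<longleftrightarrow> U ** M = M ** U"
proof
  assume "U ** M ** dagger U = M"
  then have "U ** M ** (dagger U ** U) = M ** U"
    by (simp add: matrix_mul_assoc)
  then show "U ** M = M ** U"
    by (simp add: unitariesD[OF assms])
next
  assume "U ** M = M ** U"
  then show "U ** M ** dagger U = M"
    by (simp add: unitariesD[OF assms] flip: matrix_mul_assoc)
qed

lemma mult_diag_op_nth: "(M ** diag_op d) $ x $ y = M $ x $ y * d y"
  by (simp add: matrix_matrix_mult_def diag_op_def if_distrib cong: if_cong)

text \<open>Commuting with every Z forces \<open>U\<close> to be diagonal, commuting with every X then makes
  its diagonal constant.\<close>

lemma site_centralizer_UNIV: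
  assumes "U \<in> site_centralizer UNIV"
  obtains \<omega> where "U = mat \<omega>"
proof
  have off: "U $ x $ y = 0" if "x \<noteq> y" for x y
  proof -
    obtain q where q: "x q \<noteq> y q"
      using \<open>x \<noteq> y\<close> by auto
    have "(U ** site q PZ) $ x $ y = (site q PZ ** U) $ x $ y"
      using site_centralizerD[OF assms, of q] by simp
    with q show ?thesis
      unfolding pauli_string_upd on_qubit_PZ diag_op_mult_nth mult_diag_op_nth
      by (auto simp: complex_eq_iff split: if_splits)
  qed
  have flip: "U $ (x(q := \<not> x q)) $ (x(q := \<not> x q)) = U $ x $ x" for x q
  proof -
    have "(U ** site q PX) $ (x(q := \<not> x q)) $ x = (site q PX ** U) $ (x(q := \<not> x q)) $ x"
      using site_centralizerD[OF assms, of q] by simp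
    then show ?thesis
      unfolding pauli_string_upd on_qubit_PX mult_perm_op_nth
      by (subst (asm) perm_op_mult_nth) auto
  qed
  \<comment> \<open>Every assignment is reached from the all-zero one by flipping one bit at a
    time.\<close>
  have const: "U $ (\<lambda>q. q \<in> F) $ (\<lambda>q. q \<in> F) = U $ (\<lambda>q. False) $ (\<lambda>q. False)" for F
  proof (induction F rule: finite_induct[OF finite])
    case (2 q F)
    have "(\<lambda>r. r \<in> F)(q := \<not> q \<in> F) = (\<lambda>r. r \<in> insert q F)"
      using 2 by (auto simp: fun_eq_iff)
    with flip[of "\<lambda>r. r \<in> F" q] 2 show ?case
      by simp
  qed simp
  have "U $ x $ x = U $ (\<lambda>q. False) $ (\<lambda>q. False)" for x
    using const[of "{q. x q}"] by simp
  with off show "U = mat (U $ (\<lambda>q. False) $ (\<lambda>q. False))"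
    by (auto simp: vec_eq_iff mat_def)
qed

section \<open>Restoring the images of X and Z qubit by qubit\<close>

context clifford_generators
begin

text \<open>The required operator is \<open>rot (M' M)\<close>.\<close>

lemma exchange:
  assumes "M \<in> pauli_group" "M ** M = mat 1" "M' \<in> pauli_group" "M' ** M' = mat 1"
    and anti: "M ** M' = - (M' ** M)"
  obtains g where "g \<in> G" "g \<in> clifford_group" "g ** M ** dagger g = M'"
    "\<And>N. N ** M = M ** N \<Longrightarrow> N ** M' = M' ** N \<Longrightarrow> g ** N = N ** g"
    "\<And>N. N ** M = - (M ** N) \<Longrightarrow> N ** M' = - (M' ** N) \<Longrightarrow> g ** N = N ** g"
proof
  define R where "R = M' ** M"
  have RM: "R ** M = M'"
    using assms(2) by (simp add: R_def flip: matrix_mul_assoc)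
  have MR: "M ** R = - M'"
    using assms(2) by (simp add: R_def anti matrix_mul_assoc)
      (simp flip: matrix_mul_assoc)
  have R: "R \<in> pauli_group"
    by (simp add: R_def assms pauli_group_mult)
  have RR: "R ** R = - mat 1"
    using MR assms(4) by (simp add: R_def flip: matrix_mul_assoc)
  show "rot R \<in> G" "rot R \<in> clifford_group"
    using R RR by (rule rot_mem, rule rot_clifford)
  show "rot R ** M ** dagger (rot R) = M'"
    using rot_conj_anticommute[OF pauli_group_unitary[OF R] RR, of M] by (simp add: RM MR)
  show "rot R ** N = N ** rot R" if "N ** M = M ** N" "N ** M' = M' ** N" for N
  proof (rule rot_commute)
    have "N ** R = (N ** M') ** M"
      by (simp add: R_def matrix_mul_assoc)
    also have "\<dots> = M' ** (N ** M)"
      by (simp add: that(2) matrix_mul_assoc)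
    finally show "R ** N = N ** R"
      by (simp add: that(1) R_def matrix_mul_assoc)
  qed
  \<comment> \<open>Passing \<open>N\<close> through both factors of \<open>R\<close> produces two
    signs, which cancel.\<close>
  show "rot R ** N = N ** rot R" if "N ** M = - (M ** N)" "N ** M' = - (M' ** N)" for N
  proof (rule rot_commute)
    have "N ** R = (N ** M') ** M"
      by (simp add: R_def matrix_mul_assoc)
    also have "\<dots> = - (M' ** (N ** M))"
      by (simp add: that(2) matrix_mul_assoc)
    finally show "R ** N = N ** R"
      by (simp add: that(1) R_def matrix_mul_assoc)
  qed
qed

text \<open>Operators commuting with both \<open>M\<close> and \<open>M'\<close> commute with
  \<open>g\<close>, so an exchange does not disturb qubits already treated.\<close>

lemma exchange_centralizer:
  assumes "M \<in> pauli_group" "M ** M = mat 1" "M' \<in> pauli_group" "M' ** M' = mat 1"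
    and "M ** M' = - (M' ** M)"
    and "M \<in> site_centralizer T" "M' \<in> site_centralizer T"
  obtains g where "g \<in> G \<inter> clifford_group \<inter> site_centralizer T" "g ** M ** dagger g = M'"
    "\<And>N. N ** M = - (M ** N) \<Longrightarrow> N ** M' = - (M' ** N) \<Longrightarrow> g ** N = N ** g"
proof -
  obtain g where g: "g \<in> G" "g \<in> clifford_group" "g ** M ** dagger g = M'"
    "\<And>N. N ** M = M ** N \<Longrightarrow> N ** M' = M' ** N \<Longrightarrow> g ** N = N ** g"
    "\<And>N. N ** M = - (M ** N) \<Longrightarrow> N ** M' = - (M' ** N) \<Longrightarrow> g ** N = N ** g"
    using exchange[OF assms(1-5)] by blast
  have "g \<in> site_centralizer T"
    unfolding site_centralizer_def
    using g(4) site_centralizerD[OF assms(6)] site_centralizerD[OF assms(7)] by simp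
  with g that show thesis
    by blast
qed

text \<open>For \<open>M\<close> and \<open>M'\<close> that need not anticommute, a detour through
  an \<open>N\<close> anticommuting with both. The last clause serves to keep X fixed while Z is
  being restored.\<close>

lemma exchange_twice:
  assumes M: "M \<in> pauli_group" "M ** M = mat 1" "M \<in> site_centralizer T"
    and M': "M' \<in> pauli_group" "M' ** M' = mat 1" "M' \<in> site_centralizer T"
    and N: "N \<in> pauli_group" "N ** N = mat 1" "N \<in> site_centralizer T"
    and anti: "M ** N = - (N ** M)" "N ** M' = - (M' ** N)"
  obtains g where "g \<in> G \<inter> clifford_group \<inter> site_centralizer T" "g ** M ** dagger g = M'"
    "\<And>L. L ** M = - (M ** L) \<Longrightarrow> L ** M' = - (M' ** L) \<Longrightarrow> L ** N = - (N ** L) \<Longrightarrow> g ** L = L ** g"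
proof -
  obtain g where g: "g \<in> G \<inter> clifford_group \<inter> site_centralizer T" "g ** M ** dagger g = N"
    "\<And>L. L ** M = - (M ** L) \<Longrightarrow> L ** N = - (N ** L) \<Longrightarrow> g ** L = L ** g"
    using exchange_centralizer[OF M(1,2) N(1,2) anti(1) M(3) N(3)] by blast
  obtain h where h: "h \<in> G \<inter> clifford_group \<inter> site_centralizer T" "h ** N ** dagger h = M'"
    "\<And>L. L ** N = - (N ** L) \<Longrightarrow> L ** M' = - (M' ** L) \<Longrightarrow> h ** L = L ** h"
    using exchange_centralizer[OF N(1,2) M'(1,2) anti(2) N(3) M'(3)] by blast
  show thesis
  proof
    show "h ** g \<in> G \<inter> clifford_group \<inter> site_centralizer T"
      using g(1) h(1) by (simp add: mult clifford_group_mult site_centralizer_mult)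
    show "h ** g ** M ** dagger (h ** g) = M'"
      by (simp only: conj_conj g(2) h(2))
    show "h ** g ** L = L ** (h ** g)"
      if "L ** M = - (M ** L)" "L ** M' = - (M' ** L)" "L ** N = - (N ** L)" for L
    proof -
      have "h ** g ** L = h ** (g ** L)"
        by (simp add: matrix_mul_assoc)
      also have "\<dots> = (h ** L) ** g"
        by (simp add: g(3) that matrix_mul_assoc)
      finally show ?thesis
        by (simp add: h(3) that matrix_mul_assoc)
    qed
  qed
qed

lemma move_to_X:
  assumes M: "M \<in> pauli_group" "M ** M = mat 1" "M \<in> site_centralizer T"
    and "q \<notin> T" "M \<noteq> mat 1" "M \<noteq> - mat 1"
  obtains g where "g \<in> G \<inter> clifford_group \<inter> site_centralizer T" "g ** M ** dagger g = site q PX"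
proof -
  have X: "site q PX \<in> pauli_group" "site q PX ** site q PX = mat 1" "site q PX \<in> site_centralizer T"
    using \<open>q \<notin> T\<close> by (auto intro: site_in_site_centralizer)
  show thesis
  proof (cases "M ** site q PX = - (site q PX ** M)")
    case True
    then show thesis
      using exchange_centralizer[OF M(1,2) X(1,2) _ M(3) X(3)] that by metis
  next
    case False
    obtain s P where s: "s = 1 \<or> s = -1" and MP: "M = s *\<^sub>c pauli_string P"
      using pauli_involution_cases[OF M(1,2)] by metis
    from s have "s \<noteq> 0"
      by auto
    have off: "P r = PI" if "r \<in> T" for r
      using M(3) \<open>s \<noteq> 0\<close> that pauli_string_PI_if_centralizer
      unfolding MP by (metis cscale_site_centralizer_iff)
    have Pq: "P q = PI \<or> P q = PX"
    proof (rule ccontr)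
      assume "\<not> (P q = PI \<or> P q = PX)"
      then have "pauli_string P ** site q PX = - (site q PX ** pauli_string P)"
        by (intro pauli_string_site_anticommute) auto
      with False show False
        by (simp add: MP)
    qed
    \<comment> \<open>The intermediate operator for the detour, trivial on \<open>T\<close>. Its Z
      at \<open>q\<close> anticommutes with the X there, and also with \<open>P\<close> if
      \<open>P q\<close> is X. If \<open>P\<close> is trivial at \<open>q\<close>, a second letter
      is placed where \<open>P\<close> is not; such a site exists since \<open>M\<close> is neither
      1 nor -1.\<close>
    obtain Q where Q: "\<And>r. r \<in> T \<Longrightarrow> Q r = PI" "string_sign P Q = -1" "Q q = PZ"
    proof (cases "P q = PI")
      case True
      have "P \<noteq> (\<lambda>_. PI)"
        using assms(5,6) s by (auto simp: MP minus_mat_one)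
      then obtain r where r: "P r \<noteq> PI"
        by auto
      then have "r \<noteq> q" "r \<notin> T"
        using True off by auto
      obtain B where B: "B \<noteq> PI" "B \<noteq> P r"
        using ex_pauli_other by metis
      show thesis
      proof (rule that[of "(\<lambda>_. PI)(q := PZ, r := B)"])
        show "string_sign P ((\<lambda>_. PI)(q := PZ, r := B)) = -1"
          using True r B \<open>r \<noteq> q\<close> by (subst string_sign_except[of r]) (auto simp: pauli_sign_def)
      qed (use \<open>r \<noteq> q\<close> \<open>r \<notin> T\<close> \<open>q \<notin> T\<close> in auto)
    next
      case False
      show thesis
      proof (rule that[of "(\<lambda>_. PI)(q := PZ)"])
        show "string_sign P ((\<lambda>_. PI)(q := PZ)) = -1"
          using False Pq by (subst string_sign_except[of q]) (auto simp: pauli_sign_def)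
      qed (use \<open>q \<notin> T\<close> in auto)
    qed
    have "pauli_string Q ** site r A = site r A ** pauli_string Q" if "r \<in> T" for r A
      using Q(1)[OF that] by (subst pauli_string_commute, subst string_sign_except[of r]) auto
    then have cent: "pauli_string Q \<in> site_centralizer T"
      by (simp add: site_centralizer_def)
    have "M ** pauli_string Q = - (pauli_string Q ** M)"
      by (simp add: MP pauli_string_commute[of P Q] Q(2))
    moreover have "pauli_string Q ** site q PX = - (site q PX ** pauli_string Q)"
      using Q(3) by (intro pauli_string_site_anticommute) auto
    ultimately show thesis
      using exchange_twice[OF M X pauli_string_in_pauli_group pauli_string_square cent] that by metis
  qed
qed

text \<open>The exchange runs directly to Z or through Y. All operators on the way anticommute with
  X on \<open>q\<close>, so X stays fixed.\<close>

lemma move_to_Z: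
  assumes M: "M \<in> pauli_group" "M ** M = mat 1" "M \<in> site_centralizer T"
    and "q \<notin> T" and anti: "M ** site q PX = - (site q PX ** M)"
  obtains g where "g \<in> G \<inter> clifford_group \<inter> site_centralizer T" "g ** M ** dagger g = site q PZ"
    "g ** site q PX = site q PX ** g"
proof -
  have site: "site q A \<in> pauli_group" "site q A ** site q A = mat 1" "site q A \<in> site_centralizer T" for A
    using \<open>q \<notin> T\<close> by (auto intro: site_in_site_centralizer)
  have anti': "site q PX ** M = - (M ** site q PX)"
    using anti by simp
  have XZ: "site q PX ** site q PZ = - (site q PZ ** site q PX)"
    and XY: "site q PX ** site q PY = - (site q PY ** site q PX)"
    and YZ: "site q PY ** site q PZ = - (site q PZ ** site q PY)"
    by (rule site_anticommute; simp)+
  show thesis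
  proof (cases "M ** site q PZ = - (site q PZ ** M)")
    case True
    show thesis
      by (rule exchange_centralizer[OF M(1,2) site(1,2) True M(3) site(3)])
        (rule that, assumption, assumption, metis anti' XZ)
  next
    case False
    then have comm: "M ** site q PZ = site q PZ ** M"
      using pauli_group_commute[OF M(1) site(1)] by blast
    \<comment> \<open>Anticommuting with X and commuting with Z, \<open>M\<close> anticommutes with
      their product, which is Y up to phase.\<close>
    have "M ** (site q PX ** site q PZ) = (M ** site q PX) ** site q PZ"
      by (simp add: matrix_mul_assoc)
    also have "\<dots> = - (site q PX ** (M ** site q PZ))"
      by (simp add: anti matrix_mul_assoc)
    also have "\<dots> = - (site q PX ** site q PZ ** M)"
      by (simp add: comm matrix_mul_assoc)
    finally have MY: "M ** site q PY = - (site q PY ** M)"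
      by (simp add: site_PY)
    show thesis
      by (rule exchange_twice[OF M site[of PZ] site[of PY] MY YZ])
        (rule that, assumption, assumption, metis anti' XZ XY)
  qed
qed

text \<open>Symplectic elimination by induction on \<open>T\<close>: for a new qubit the image of X
  is moved back to X, then the image of Z back to Z with X held fixed. All factors centralise the
  earlier sites.\<close>

lemma ex_centralizing_mult:
  assumes "A \<in> clifford_group"
  shows "\<exists>g\<in>G \<inter> clifford_group. g ** A \<in> site_centralizer T"
proof (induction T rule: finite_induct[OF finite])
  case 1
  have "mat 1 \<in> G" "mat 1 \<in> clifford_group"
    using phase[of 1] subgroup.one_closed[OF subgroup_clifford_group] by (auto simp: unitary_group_def)
  then show ?case
    by (intro bexI[of _ "mat 1"]) (auto simp: site_centralizer_def)
next
  case (2 q T)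
  then obtain g where g: "g \<in> G" "g \<in> clifford_group" "g ** A \<in> site_centralizer T"
    by blast
  define B where "B = g ** A"
  have B: "B \<in> clifford_group" "B \<in> unitaries" "B \<in> site_centralizer T"
    using g assms by (auto simp: B_def clifford_group_mult clifford_group_unitary)
  have conj: "C ** site q D ** dagger C \<in> pauli_group"
    "(C ** site q D ** dagger C) ** (C ** site q D ** dagger C) = mat 1"
    "C ** site q D ** dagger C \<in> site_centralizer T"
    if "C \<in> clifford_group" "C \<in> site_centralizer T" for C D
  proof -
    have C: "C \<in> unitaries"
      using that(1) by (rule clifford_group_unitary)
    show "C ** site q D ** dagger C \<in> pauli_group"
      using that(1) by (rule clifford_groupD) simp
    show "(C ** site q D ** dagger C) ** (C ** site q D ** dagger C) = mat 1"
      by (simp add: conj_mult[OF C] unitariesD[OF C])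
    show "C ** site q D ** dagger C \<in> site_centralizer T"
      unfolding site_centralizer_def
    proof (intro CollectI ballI allI)
      fix r E assume "r \<in> T"
      then have "C ** site r E ** dagger C = site r E"
        using conj_eq_iff_commute[OF C] site_centralizerD[OF that(2)] by blast
      moreover have "site q D ** site r E = site r E ** site q D"
        using \<open>r \<in> T\<close> 2 by (intro site_commute) auto
      ultimately show "C ** site q D ** dagger C ** site r E = site r E ** (C ** site q D ** dagger C)"
        using conj_mult[OF C, of "site q D" "site r E"] conj_mult[OF C, of "site r E" "site q D"] by simp
    qed
  qed
  have conj_anti: "(C ** site q PX ** dagger C) ** (C ** site q PZ ** dagger C)
      = - ((C ** site q PZ ** dagger C) ** (C ** site q PX ** dagger C))"
    if "C \<in> unitaries" for C
    unfolding conj_mult[OF that] by (subst site_anticommute) auto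
  define M where "M = B ** site q PX ** dagger B"
  \<comment> \<open>A scalar would commute with the image of Z, but conjugation preserves the
    anticommutation of X and Z.\<close>
  have "M \<noteq> mat 1 \<and> M \<noteq> - mat 1"
  proof (rule ccontr)
    define N where "N = B ** site q PZ ** dagger B"
    assume "\<not> ?thesis"
    then have "M ** N = N ** M"
      by auto
    moreover have "M ** N = - (N ** M)"
      unfolding M_def N_def by (rule conj_anti[OF B(2)])
    moreover have "M \<in> unitaries" "N \<in> unitaries"
      unfolding M_def N_def using conj(1)[OF B(1,3)] pauli_group_unitary by blast+
    ultimately show False
      using not_commute_and_anticommute by blast
  qed
  then obtain g1 where g1: "g1 \<in> G \<inter> clifford_group \<inter> site_centralizer T"
      "g1 ** M ** dagger g1 = site q PX"
    using move_to_X[OF conj[OF B(1,3), of PX], of q] 2 M_def by metis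
  define B1 where "B1 = g1 ** B"
  have B1: "B1 \<in> clifford_group" "B1 \<in> unitaries" "B1 \<in> site_centralizer T"
    using g1 B by (auto simp: B1_def clifford_group_mult clifford_group_unitary site_centralizer_mult)
  have B1X: "B1 ** site q PX ** dagger B1 = site q PX"
    unfolding B1_def conj_conj M_def[symmetric] by (rule g1(2))
  have "(B1 ** site q PZ ** dagger B1) ** site q PX = - (site q PX ** (B1 ** site q PZ ** dagger B1))"
    using conj_anti[OF B1(2)] unfolding B1X by simp
  then obtain g2 where g2: "g2 \<in> G \<inter> clifford_group \<inter> site_centralizer T"
      "g2 ** (B1 ** site q PZ ** dagger B1) ** dagger g2 = site q PZ"
      "g2 ** site q PX = site q PX ** g2"
    using move_to_Z[OF conj[OF B1(1,3), of PZ], of q] 2 by metis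
  define B2 where "B2 = g2 ** B1"
  have B2: "B2 \<in> unitaries" "B2 \<in> site_centralizer T"
    using g2 B1 by (auto simp: B2_def clifford_group_mult clifford_group_unitary site_centralizer_mult)
  have "g2 \<in> unitaries"
    using g2 unitary by blast
  have X: "B2 ** site q PX ** dagger B2 = site q PX"
    unfolding B2_def conj_conj B1X conj_eq_iff_commute[OF \<open>g2 \<in> unitaries\<close>] by (rule g2(3))
  have Z: "B2 ** site q PZ ** dagger B2 = site q PZ"
    unfolding B2_def conj_conj by (rule g2(2))
  have Y: "B2 ** site q PY ** dagger B2 = site q PY"
    using conj_mult[OF B2(1), of "site q PX" "site q PZ"] by (simp add: site_PY X Z)
  have "B2 ** site q D = site q D ** B2" for D
    using X Y Z unfolding conj_eq_iff_commute[OF B2(1)] by (cases D) (auto simp: fun_upd_idem)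
  with B2(2) have "B2 \<in> site_centralizer (insert q T)"
    by (simp add: site_centralizer_def)
  moreover have "B2 = (g2 ** g1 ** g) ** A"
    by (simp add: B2_def B1_def B_def matrix_mul_assoc)
  moreover have "g2 ** g1 ** g \<in> G \<inter> clifford_group"
    using g g1 g2 by (auto intro!: mult clifford_group_mult)
  ultimately show ?case
    by metis
qed

lemma clifford_group_subset: "clifford_group \<subseteq> G"
proof
  fix A :: "'q operator"
  assume A: "A \<in> clifford_group"
  then obtain g where g: "g \<in> G" "g ** A \<in> site_centralizer UNIV"
    using ex_centralizing_mult by blast
  then obtain \<omega> where \<omega>: "g ** A = mat \<omega>"
    using site_centralizer_UNIV by blast
  have "g ** A \<in> unitaries"
    using A g(1) by (simp add: clifford_group_unitary unitaries_mult unitary)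
  then have "\<omega> * cnj \<omega> = 1"
    using unitariesD(2)[of "g ** A"] by (simp add: \<omega> mat_eq_iff mult.commute)
  \<comment> \<open>Unitarity makes the remaining scalar a phase, hence an element of
    \<open>G\<close>.\<close>
  then have "(cmod \<omega>)\<^sup>2 = 1"
    by (metis complex_norm_square of_real_eq_1_iff)
  then have "cmod \<omega> = 1"
    using norm_ge_zero[of \<omega>] by (auto simp: power2_eq_1_iff)
  then have "dagger g ** (g ** A) \<in> G"
    unfolding \<omega> using mult[OF dagger[OF g(1)] phase] by blast
  then show "A \<in> G"
    by (simp add: unitariesD[OF unitary[OF g(1)]])
qed

end

section \<open>Generating sets of gates\<close>

lemma phase_subgroup_generate:
  fixes A :: "'q::finite operator set"
  assumes "A \<subseteq> unitaries"
  shows "phase_subgroup (generate_up_to_phase unitary_group A)"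
proof
  have A: "A \<subseteq> carrier unitary_group"
    using assms by (simp add: unitary_group_def)
  have gen: "B \<in> unitaries" if "B \<in> generate unitary_group A" for B
    using group.generate_in_carrier[OF group_unitary_group A that] by (simp add: unitary_group_def)
  have gen_mult: "B ** C \<in> generate unitary_group A"
    if "B \<in> generate unitary_group A" "C \<in> generate unitary_group A" for B C
    using generate.eng[OF that] by (simp add: unitary_group_def)
  have gen_one: "mat 1 \<in> generate unitary_group A"
    using generate.one[of unitary_group A] by (simp add: unitary_group_def)
  have gen_dagger: "dagger B \<in> generate unitary_group A" if "B \<in> generate unitary_group A" for B
    using group.generate_m_inv_closed[OF group_unitary_group A that] gen[OF that]
    by (simp add: inv_unitary_group)
  let ?G = "generate_up_to_phase unitary_group A"
  have memI: "\<omega> *\<^sub>c B \<in> ?G" if "cmod \<omega> = 1" "B \<in> generate unitary_group A" for \<omega> B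
    using that by (auto simp: generate_up_to_phase_alt)
  have memE: "\<exists>\<omega> B. U = \<omega> *\<^sub>c B \<and> cmod \<omega> = 1 \<and> B \<in> generate unitary_group A" if "U \<in> ?G" for U
    using that by (auto simp: generate_up_to_phase_alt)
  show "U \<in> unitaries" if "U \<in> ?G" for U
    using memE[OF that] gen by (auto intro: unitaries_cscale)
  show "mat \<omega> \<in> ?G" if "cmod \<omega> = 1" for \<omega>
    using memI[OF that gen_one] by simp
  show "U ** V \<in> ?G" if UV: "U \<in> ?G" "V \<in> ?G" for U V
  proof -
    obtain \<omega> B \<xi> C where "U = \<omega> *\<^sub>c B" "cmod \<omega> = 1" "B \<in> generate unitary_group A"
      "V = \<xi> *\<^sub>c C" "cmod \<xi> = 1" "C \<in> generate unitary_group A"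
      using memE[OF UV(1)] memE[OF UV(2)] by blast
    then show ?thesis
      using memI[of "\<xi> * \<omega>" "B ** C"] gen_mult by (simp add: norm_mult)
  qed
  show "dagger U \<in> ?G" if "U \<in> ?G" for U
    using memE[OF that] gen_dagger by (auto intro!: memI)
qed

lemma generate_up_to_phase_incl: "A \<subseteq> generate_up_to_phase unitary_group A"
proof
  fix B assume "B \<in> A"
  then have "1 *\<^sub>c B \<in> generate_up_to_phase unitary_group A"
    unfolding generate_up_to_phase_alt by (blast intro: generate.incl norm_one)
  then show "B \<in> generate_up_to_phase unitary_group A"
    by simp
qed

lemma generate_up_to_phase_clifford:
  assumes "A \<subseteq> clifford_group"
  shows "generate_up_to_phase unitary_group A \<subseteq> clifford_group"
  using group.generate_subgroup_incl[OF group_unitary_group assms subgroup_clifford_group]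
  by (auto simp: generate_up_to_phase_alt intro: cscale_clifford_group)

section \<open>Circuit identities\<close>

text \<open>CNOTs are involutions, so the left side is a commutator. On basis states the bit at
  \<open>b\<close> is restored and the bit at \<open>a\<close> is added to \<open>c\<close>.\<close>

lemma cnot_commutator:
  assumes "a \<noteq> b" "b \<noteq> c" "a \<noteq> c"
  shows "on_pairs cnot {(a, b)} ** on_pairs cnot {(b, c)} ** on_pairs cnot {(a, b)} ** on_pairs cnot {(b, c)}
    = on_pairs cnot {(a, c)}"
  unfolding on_pairs_cnot[OF assms(1)] on_pairs_cnot[OF assms(2)] on_pairs_cnot[OF assms(3)] perm_op_mult
  by (rule arg_cong[of _ _ perm_op]) (use assms in \<open>auto simp: fun_eq_iff\<close>)

text \<open>Covers both transversal gates, with \<open>B\<close> a block, and single-qubit gates,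
  with \<open>B\<close> a singleton.\<close>

definition tensor_on :: "gate1 \<Rightarrow> 'q set \<Rightarrow> 'q::finite operator" where
  "tensor_on F B = tensor (\<lambda>r. if r \<in> B then F else mat 1)"

lemma tensor_on_singleton: "tensor_on F {q} = on_qubit F q"
  by (simp add: tensor_on_def on_qubit_def)

text \<open>Only the phase contributed by \<open>b\<close> changes under the CNOT, so all others
  cancel. For bits \<open>s\<close> at \<open>a\<close> and \<open>t\<close> at \<open>b\<close> the
  quotient of \<open>\<i>\<close> to the power \<open>s xor t\<close> by \<open>\<i>\<close> to the
  power \<open>t\<close> is \<open>\<i>\<close> to the power \<open>s\<close>, times -1 if both bits
  are set.\<close>

lemma cnot_tensor_on_phase_commutator:
  assumes "a \<noteq> b" "a \<in> B" "b \<in> B"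
  shows "on_pairs cnot {(a, b)} ** tensor_on (phase_pow 1) B ** on_pairs cnot {(a, b)}
      ** dagger (tensor_on (phase_pow 1) B)
    = on_qubit (phase_pow 1) a ** on_pairs cz {(a, b)}"
proof -
  define e where "e r u = (if r \<in> B \<and> u then \<i> else 1)" for r u
  have "tensor_on (phase_pow 1) B = tensor (\<lambda>r. diag_op (e r))"
    unfolding tensor_on_def
    by (rule arg_cong[of _ _ tensor])
      (auto simp: fun_eq_iff phase_pow_eq e_def diag_op_one[symmetric] intro!: arg_cong[of _ _ diag_op])
  then have D: "tensor_on (phase_pow 1) B = diag_op (\<lambda>x. \<Prod>r\<in>UNIV. e r (x r))"
    by (simp add: tensor_diag_op)
  have "(\<Prod>r\<in>UNIV. e r (flip_target a b x r)) * cnj (\<Prod>r\<in>UNIV. e r (x r))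
      = (if x a then \<i> else 1) * (if x a \<and> x b then -1 else 1)" for x
  proof -
    have "(\<Prod>r\<in>UNIV. e r (flip_target a b x r)) * cnj (\<Prod>r\<in>UNIV. e r (x r))
        = (\<Prod>r\<in>UNIV. e r (flip_target a b x r) * cnj (e r (x r)))"
      by (simp add: prod.distrib)
    also have "\<dots> = e b (flip_target a b x b) * cnj (e b (x b))"
      by (rule prod_fun_except) (auto simp: e_def)
    also have "\<dots> = (if x a then \<i> else 1) * (if x a \<and> x b then -1 else 1)"
      using assms by (auto simp: e_def)
    finally show ?thesis .
  qed
  then show ?thesis
    unfolding D on_pairs_cnot[OF assms(1)] on_pairs_cz[OF assms(1)] on_qubit_phase
      perm_diag_perm[of "flip_target a b", OF flip_target_involution[OF assms(1)]] dagger_diag_op diag_op_mult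
    by simp
qed

lemma tensor_on_hadamard_conj:
  assumes "q \<in> B"
  shows "tensor_on hadamard B ** on_qubit F q ** tensor_on hadamard B = on_qubit (hadamard ** F ** hadamard) q"
  unfolding tensor_on_def on_qubit_def tensor_mult using assms
  by (intro arg_cong[of _ _ tensor]) (auto simp: hadamard_hadamard)

lemma phase_hadamard_phase:
  "phase_pow 1 ** (hadamard ** phase_pow 1 ** hadamard) ** phase_pow 1
    = (complex_of_real (1 / sqrt 2) * (1 + \<i>)) *\<^sub>c hadamard"
  by (simp add: vec_eq_iff matrix_matrix_mult_def UNIV_bool all_bool_eq phase_pow_eq diag_op_nth hadamard_def
      sqrt2_sqrt2 algebra_simps flip: add_divide_distrib)

section \<open>Deriving gates from one another\<close>

context phase_subgroup
begin

lemma cz_if_cnot: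
  assumes "q \<noteq> r" "on_qubit hadamard r \<in> G" "on_pairs cnot {(q, r)} \<in> G"
  shows "on_pairs cz {(q, r)} \<in> G"
  using mult[OF mult[OF assms(2,3)] assms(2)] by (simp add: hadamard_cnot_hadamard assms(1))

lemma cnot_if_cz:
  assumes "q \<noteq> r" "on_qubit hadamard r \<in> G" "on_pairs cz {(q, r)} \<in> G"
  shows "on_pairs cnot {(q, r)} \<in> G"
  using mult[OF mult[OF assms(2,3)] assms(2)] by (simp add: hadamard_cz_hadamard assms(1))

lemma cnot_trans:
  assumes "a \<noteq> b" "b \<noteq> c" "a \<noteq> c" "on_pairs cnot {(a, b)} \<in> G" "on_pairs cnot {(b, c)} \<in> G"
  shows "on_pairs cnot {(a, c)} \<in> G"
  using mult[OF mult[OF mult[OF assms(4,5)] assms(4)] assms(5)] by (simp add: cnot_commutator assms(1-3))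

lemma phase_if_cnot_cz:
  assumes "tensor_on (phase_pow 1) B \<in> G" "q \<in> B"
    and "\<And>r. r \<in> B \<Longrightarrow> q \<noteq> r \<Longrightarrow> on_pairs cnot {(q, r)} \<in> G \<and> on_pairs cz {(q, r)} \<in> G"
  shows "on_qubit (phase_pow 1) q \<in> G"
\<comment> \<open>A block with a single qubit has no inner pairs, but there the transversal S is
  already the gate itself.\<close>
proof (cases "B = {q}")
  case True
  with assms(1) show ?thesis
    by (simp add: tensor_on_singleton)
next
  case False
  then obtain r where r: "r \<in> B" "q \<noteq> r"
    using assms(2) by auto
  with assms(3) have cnot: "on_pairs cnot {(q, r)} \<in> G" and cz: "on_pairs cz {(q, r)} \<in> G"
    by auto
  have "on_qubit (phase_pow 1) q ** on_pairs cz {(q, r)} \<in> G"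
    using mult[OF mult[OF mult[OF cnot assms(1)] cnot] dagger[OF assms(1)]]
    by (simp add: cnot_tensor_on_phase_commutator assms(2) r)
  then have "on_qubit (phase_pow 1) q ** on_pairs cz {(q, r)} ** on_pairs cz {(q, r)} \<in> G"
    using cz by (rule mult)
  also have "on_qubit (phase_pow 1) q ** on_pairs cz {(q, r)} ** on_pairs cz {(q, r)} = on_qubit (phase_pow 1) q"
    unfolding on_qubit_phase on_pairs_cz[OF r(2)] diag_op_mult by (rule arg_cong[of _ _ diag_op]) auto
  finally show ?thesis .
qed

lemma hadamard_if_phase:
  assumes "tensor_on hadamard B \<in> G" "q \<in> B" "on_qubit (phase_pow 1) q \<in> G"
  shows "on_qubit hadamard q \<in> G"
proof -
  define \<omega> where "\<omega> = complex_of_real (1 / sqrt 2) * (1 + \<i>)"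
  have \<omega>: "cmod \<omega> = 1"
    unfolding \<omega>_def by (rule cmod_eighth_root)
  have "on_qubit (hadamard ** phase_pow 1 ** hadamard) q \<in> G"
    using mult[OF mult[OF assms(1,3)] assms(1)] by (simp add: tensor_on_hadamard_conj assms(2))
  from mult[OF mult[OF assms(3) this] assms(3)]
  have "\<omega> *\<^sub>c on_qubit hadamard q \<in> G"
    by (simp add: on_qubit_mult phase_hadamard_phase on_qubit_cscale \<omega>_def)
  \<comment> \<open>Multiplying by the conjugate phase removes the eighth root of unity.\<close>
  then have "cnj \<omega> *\<^sub>c \<omega> *\<^sub>c on_qubit hadamard q \<in> G"
    by (rule cscale[rotated]) (simp add: \<omega>)
  then show ?thesis
    by (simp add: cnj_mult_self_eq_1 \<omega>)
qed

end

section \<open>The generating sets of the theorem\<close>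

abbreviation block :: "'m \<Rightarrow> ('m \<times> 'k) set" where
  "block p \<equiv> {p} \<times> UNIV"

lemma tensor_on_block_transversal:
  fixes p :: "'m::finite"
  defines "B \<equiv> block p :: ('m \<times> 'k::finite) set"
  shows "tensor_on hadamard B \<in> transversal_gates" "tensor_on (phase_pow 1) B \<in> transversal_gates"
proof -
  have eq: "tensor_on F B = tensor (\<lambda>(r, j). if r = p then F else mat 1)" for F
    unfolding tensor_on_def B_def by (rule arg_cong[of _ _ tensor]) auto
  show "tensor_on hadamard B \<in> transversal_gates"
    unfolding eq transversal_gates_def by blast
  have "tensor_on (phase_pow 1) B
      \<in> {tensor (\<lambda>(r, j). if r = p then phase_pow (a j) else mat 1) | p a. range a \<subseteq> {-1, 1}}"
    unfolding eq by (intro CollectI exI[of _ p] exI[of _ "\<lambda>_. 1"] conjI) auto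
  then show "tensor_on (phase_pow 1) B \<in> transversal_gates"
    by (simp add: transversal_gates_def)
qed

text \<open>H exchanges CNOT and CZ; CNOT and CZ inside a block give S from the transversal S; S
  gives H from the transversal H. From each intra-block choice these implications reach H, S and all
  CNOTs inside blocks.\<close>

lemma clifford_generators_if_choices:
  fixes G intra inter :: "('m::finite \<times> 'k::finite) operator set"
  assumes "phase_subgroup G" and transversal: "transversal_gates \<subseteq> G"
    and intra: "intra \<in> intra_block_choices" "intra \<subseteq> G"
    and inter: "inter \<in> inter_block_choices j1" "inter \<subseteq> G"
  shows "clifford_generators G"
proof -
  interpret phase_subgroup G
    by (rule assms(1))
  define H where "H \<longleftrightarrow> (\<forall>p j. on_qubit hadamard (p, j) \<in> G)"
  define S where "S \<longleftrightarrow> (\<forall>p j. on_qubit (phase_pow 1) (p, j) \<in> G)"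
  define pairs where "pairs F \<longleftrightarrow> (\<forall>p j l. j \<noteq> l \<longrightarrow> on_pairs F {((p, j), (p, l))} \<in> G)" for F
  have tensor_block: "tensor_on hadamard (block p) \<in> G" "tensor_on (phase_pow 1) (block p) \<in> G" for p :: 'm
    using transversal tensor_on_block_transversal by blast+
  have cz_if: "pairs cz" if "H" "pairs cnot"
    using that cz_if_cnot by (simp add: H_def pairs_def)
  have cnot_if: "pairs cnot" if "H" "pairs cz"
    using that cnot_if_cz by (simp add: H_def pairs_def)
  have S_if: S if "pairs cnot" "pairs cz"
    unfolding S_def
  proof (intro allI)
    fix p j
    show "on_qubit (phase_pow 1) (p, j) \<in> G"
    proof (rule phase_if_cnot_cz[OF tensor_block(2)[of p]])
      fix r :: "'m \<times> 'k"
      assume "r \<in> block p" "(p, j) \<noteq> r"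
      then obtain l where "r = (p, l)" "j \<noteq> l"
        by auto
      with that show "on_pairs cnot {((p, j), r)} \<in> G \<and> on_pairs cz {((p, j), r)} \<in> G"
        by (simp add: pairs_def)
    qed simp
  qed
  have H_if: H if S
    unfolding H_def
  proof (intro allI)
    fix p j
    show "on_qubit hadamard (p, j) \<in> G"
      using that by (intro hadamard_if_phase[OF tensor_block(1)[of p]]) (auto simp: S_def)
  qed
  have H: "H" if "block_hadamard \<subseteq> G"
    using that by (auto simp: H_def block_hadamard_def)
  have S: "S" if "block_phase \<subseteq> G"
    using that by (auto simp: S_def block_phase_def)
  have pairs: "pairs F" if "block_pairs F \<subseteq> G" for F
    using that by (auto simp: pairs_def block_pairs_def)
  have HSC: "H \<and> S \<and> pairs cnot"
    using intra H S pairs cz_if cnot_if S_if H_if by (auto simp: intra_block_choices_def)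
  have hadamard: "on_qubit hadamard q \<in> G" and phase_gate: "on_qubit (phase_pow 1) q \<in> G" for q
    using HSC by (cases q; simp add: H_def S_def)+
  have inside: "on_pairs cnot {((p, j), (p, l))} \<in> G" if "j \<noteq> l" for p j l
    using HSC that by (simp add: pairs_def)
  have first: "on_pairs cnot {((p, j1), (q, j1))} \<in> G" if "p \<noteq> q" for p q
  proof -
    have "on_pairs cnot {((p, j1), (q, j1))} \<in> G \<or> on_pairs cz {((p, j1), (q, j1))} \<in> G"
      using inter that by (auto simp: inter_block_choices_def inter_pairs_def)
    then show ?thesis
      using cnot_if_cz hadamard that by blast
  qed
  \<comment> \<open>CNOTs are chained along \<open>(p, j)\<close>, \<open>(p, j1)\<close>,
    \<open>(q, j1)\<close>, \<open>(q, l)\<close>, where a link inside a block drops out if its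
    endpoints coincide.\<close>
  have to_first: "on_pairs cnot {((p, j), (q, j1))} \<in> G" if "p \<noteq> q" for p q j
    using cnot_trans[of "(p, j)" "(p, j1)" "(q, j1)"] first[OF that] inside[of j j1 p] that
    by (cases "j = j1") auto
  have across: "on_pairs cnot {((p, j), (q, l))} \<in> G" if "p \<noteq> q" for p q j l
    using cnot_trans[of "(p, j)" "(q, j1)" "(q, l)"] to_first[OF that] inside[of j1 l q] that
    by (cases "l = j1") auto
  have "on_pairs cnot {(q, r)} \<in> G" if "q \<noteq> r" for q r
    using that inside across by (cases q; cases r) (metis Pair_inject)
  with hadamard phase_gate show ?thesis
    by unfold_locales
qed

lemma transversal_gates_clifford: "transversal_gates \<subseteq> clifford_group"
proof -
  have "disjoint_pairs {((p, j), (q, j)) | j. True}" if "p \<noteq> q" for p q :: 'a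
    using that by (auto simp: disjoint_pairs_def inj_on_def)
  moreover have "clifford_gate (phase_pow (a j))" if "range a \<subseteq> {-1, 1}" for a :: "'b \<Rightarrow> int" and j
    using that by (intro clifford_gate_phase) auto
  ultimately show ?thesis
    unfolding transversal_gates_def
    by (auto intro!: tensor_clifford on_pairs_cnot_disjoint_clifford clifford_gate_hadamard clifford_gate_one)
qed

lemma block_gates_clifford:
  "block_hadamard \<subseteq> clifford_group" "block_phase \<subseteq> clifford_group"
  "block_pairs cnot \<subseteq> clifford_group" "block_pairs cz \<subseteq> clifford_group"
  "inter_pairs cnot j \<subseteq> clifford_group" "inter_pairs cz j \<subseteq> clifford_group"
  by (auto simp: block_hadamard_def block_phase_def block_pairs_def inter_pairs_def
      intro!: on_qubit_clifford clifford_gate_hadamard clifford_gate_phase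
        on_pairs_cnot_clifford on_pairs_cz_clifford)

(* The type 'm indexes the blocks and 'k the logical qubits of a block; j1 is the logical qubit
   labelled 1. *)
theorem proposition1:
  fixes \<S> :: "'n::finite operator set"
    and V :: "complex^('k::finite \<Rightarrow> bool)^('n \<Rightarrow> bool)"
    and W :: "complex^('m::finite \<times> 'k \<Rightarrow> bool)^('m \<times> 'n \<Rightarrow> bool)"
    and d :: nat and j1 :: 'k
    and intra inter :: "('m \<times> 'k) operator set"
  assumes "stabilizer_code \<S> CARD('k) d"
    and "encoding \<S> V"
    and "W = block_encoding V"
    and "intra \<in> intra_block_choices"
    and "inter \<in> inter_block_choices j1"
  shows "generate_up_to_phase (logical_unitary_group W)
           (logical W ` (transversal_gates \<union> intra \<union> inter))
         = logical W ` clifford_group"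
proof -
  let ?A = "transversal_gates \<union> intra \<union> inter"
  have "intra \<subseteq> clifford_group" "inter \<subseteq> clifford_group"
    using assms(4,5) block_gates_clifford(1-4) block_gates_clifford(5,6)[of j1]
    by (auto simp: intra_block_choices_def inter_block_choices_def)
  with transversal_gates_clifford have A: "?A \<subseteq> clifford_group"
    by blast
  then have U: "?A \<subseteq> unitaries"
    using clifford_group_unitary by blast
  have "clifford_generators (generate_up_to_phase unitary_group ?A)"
    using assms(4,5) generate_up_to_phase_incl[of ?A] phase_subgroup_generate[OF U]
    by (intro clifford_generators_if_choices) auto
  then have "clifford_group \<subseteq> generate_up_to_phase unitary_group ?A"
    by (rule clifford_generators.clifford_group_subset)
  with generate_up_to_phase_clifford[OF A]
  have "generate_up_to_phase unitary_group ?A = clifford_group"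
    by blast
  moreover have "dagger W ** W = mat 1"
    using assms(2,3) by (simp add: encoding_def block_encoding_isometry)
  ultimately show ?thesis
    by (simp only: generate_up_to_phase_logical[OF _ U])
qed

end
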